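(* Let $K$ be a field of arbitrary characteristic. Let $f(X)=X^r+a_{r-1}X^{r-1}+\dots+a_1X+a_0\in K[X]$ and $\varphi(X,Z)=Z^d+c_{d-1}(X)Z^{d-1}+\dots+c_1(X)Z+c_0(X)\in K[X,Z]$ (with $c_i\in K[X]$), where $d\ge 2$ and $r\ge 2$, and let $$A=\frac{K[X,Y,Z]}{(f(X)Y-\varphi(X,Z))}.$$ Let $x$ denote the image of $X$ in $A$. Then $\mathrm{ML}(A)=K[x]$ and $\mathrm{DK}(A)=K[x]$.
   Context: Exponential map: for a $K$-algebra $A$ and an indeterminate $U$, a $K$-algebra homomorphism $\phi=\phi_U:A\to A[U]$ is an exponential map on $A$ if (i) $\epsilon_0\circ\phi_U$ is the identity on $A$, where $\epsilon_0:A[U]\to A$ is evaluation at $U=0$; and (ii) $\phi_V\circ\phi_U=\phi_{V+U}$, where $V$ is another indeterminate and $\phi_V:A\to A[V]$ is extended to $\phi_V:A[U]\to A[U,V]$ by $\phi_V(U)=U$. The ring of invariants of $\phi$ is $A^{\phi}=\{a\in A:\phi(a)=a\}$; $\phi$ is trivial if $A^{\phi}=A$, and nontrivial otherwise. For an affine $K$-domain $A$ (a finitely generated $K$-algebra that is an integral domain), the Makar-Limanov invariant is $\mathrm{ML}(A)=\bigcap_{\phi}A^{\phi}$, the intersection over all exponential maps $\phi$ on $A$, and the Derksen invariant $\mathrm{DK}(A)$ is the $K$-subalgebra of $A$ generated by the rings of invariants $A^{\phi}$ of all nontrivial exponential maps $\phi$ on $A$. *)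

theory Defs
  imports
    "HOL-Algebra.Algebraic_Closure_Type"
    "HOL-Algebra.UnivPoly"
    "HOL-Algebra.Generated_Rings"
    "HOL-Computational_Algebra.Polynomial"
begin

text \<open>
  A \<open>K\<close>-algebra is given by a ring record \<open>A\<close> together with its structure map \<open>\<iota> :: 'k \<Rightarrow> 'a\<close>
  from the field \<open>K\<close>, the type \<open>'k\<close>.

  \<open>A[U]\<close> is \<open>UP A\<close>, and \<open>A[U,V]\<close> is \<open>UP (UP A) = A[V][U]\<close>:
  the coefficients are polynomials in \<open>V\<close>, the outer indeterminate is \<open>U\<close>.
\<close>

definition upoly_const :: "('a, 'm) ring_scheme \<Rightarrow> 'a \<Rightarrow> nat \<Rightarrow> 'a" where
  "upoly_const R a = up_ring.monom (UP R) a 0"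

definition upoly_var :: "('a, 'm) ring_scheme \<Rightarrow> nat \<Rightarrow> 'a" where
  "upoly_var R = up_ring.monom (UP R) \<one>\<^bsub>R\<^esub> 1"

definition exponential_map ::
    "('a, 'm) ring_scheme \<Rightarrow> ('k::field \<Rightarrow> 'a) \<Rightarrow> ('a \<Rightarrow> nat \<Rightarrow> 'a) \<Rightarrow> bool" where
  "exponential_map A \<iota> \<phi> \<longleftrightarrow>
     \<phi> \<in> ring_hom A (UP A) \<and>
     (\<forall>c. \<phi> (\<iota> c) = upoly_const A (\<iota> c)) \<and>
     (\<forall>a \<in> carrier A. eval A A (\<lambda>b. b) \<zero>\<^bsub>A\<^esub> (\<phi> a) = a) \<and>
     (let AV = UP A;
          AUV = UP AV;
          U = upoly_var AV;
          V = upoly_const AV (upoly_var A);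
          \<phi>\<^sub>V = eval A AUV (\<lambda>b. upoly_const AV (\<phi> b)) U;
          U_to_VU = eval A AUV (\<lambda>b. upoly_const AV (upoly_const A b)) (V \<oplus>\<^bsub>AUV\<^esub> U)
      in \<forall>a \<in> carrier A. \<phi>\<^sub>V (\<phi> a) = U_to_VU (\<phi> a))"

definition exp_invariants :: "('a, 'm) ring_scheme \<Rightarrow> ('a \<Rightarrow> nat \<Rightarrow> 'a) \<Rightarrow> 'a set" where
  "exp_invariants A \<phi> = {a \<in> carrier A. \<phi> a = upoly_const A a}"

definition generated_subalgebra ::
    "('a, 'm) ring_scheme \<Rightarrow> ('k::field \<Rightarrow> 'a) \<Rightarrow> 'a set \<Rightarrow> 'a set" where
  "generated_subalgebra A \<iota> S = generate_ring A (range \<iota> \<union> S)"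

definition makar_limanov :: "('a, 'm) ring_scheme \<Rightarrow> ('k::field \<Rightarrow> 'a) \<Rightarrow> 'a set" where
  "makar_limanov A \<iota> = (\<Inter>\<phi> \<in> {\<phi>. exponential_map A \<iota> \<phi>}. exp_invariants A \<phi>)"

definition derksen :: "('a, 'm) ring_scheme \<Rightarrow> ('k::field \<Rightarrow> 'a) \<Rightarrow> 'a set" where
  "derksen A \<iota> = generated_subalgebra A \<iota>
     (\<Union>\<phi> \<in> {\<phi>. exponential_map A \<iota> \<phi> \<and> exp_invariants A \<phi> \<noteq> carrier A}. exp_invariants A \<phi>)"

text \<open>
  \<open>K[X,Y,Z]\<close> is realised as \<open>K[X][Z][Y]\<close>, i.e. \<open>'k poly poly poly\<close> with innermost
  indeterminate \<open>X\<close> and outermost indeterminate \<open>Y\<close>; accordingly \<open>K[X,Z]\<close> is \<open>'k poly poly\<close>.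
\<close>

abbreviation KXYZ :: "'k::field poly poly poly ring" where
  "KXYZ \<equiv> ring_of_type_algebra"

definition surface_ideal :: "'k::field poly \<Rightarrow> 'k poly poly \<Rightarrow> 'k poly poly poly set" where
  "surface_ideal f \<phi> = PIdl\<^bsub>KXYZ\<^esub> ([:[:f:]:] * [:0, 1:] - [:\<phi>:])"

definition surface_ring :: "'k::field poly \<Rightarrow> 'k poly poly \<Rightarrow> 'k poly poly poly set ring" where
  "surface_ring f \<phi> = KXYZ Quot surface_ideal f \<phi>"

definition surface_emb ::
    "'k::field poly \<Rightarrow> 'k poly poly \<Rightarrow> 'k \<Rightarrow> 'k poly poly poly set" where
  "surface_emb f \<phi> c = surface_ideal f \<phi> +>\<^bsub>KXYZ\<^esub> [:[:[:c:]:]:]"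

definition surface_x :: "'k::field poly \<Rightarrow> 'k poly poly \<Rightarrow> 'k poly poly poly set" where
  "surface_x f \<phi> = surface_ideal f \<phi> +>\<^bsub>KXYZ\<^esub> [:[:[:0, 1:]:]:]"

end

theory Submission
  imports Defs
begin

text \<open>
  Let \<open>x\<close>, \<open>y\<close>, \<open>z\<close> be the images of the variables in \<open>A\<close>. It suffices to prove that every nontrivial
  exponential map on \<open>A\<close> has ring of invariants \<open>K[x]\<close>, and that there is a nontrivial one. The
  substitution \<open>Z \<mapsto> Z + f U\<close> is nontrivial (\<open>exponential_map_shear\<close>). The classification
  (\<open>trivial_or_invariants_polynomials\<close>) rests on a passage to leading terms, as follows.

  Since \<open>y = \<phi>/f\<close>, the ring \<open>A\<close> is a subring of \<open>K((1/X))[Z]\<close>. It is free over \<open>K[x]\<close> with basis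
  \<open>b_n = y^(n div d) z^(n mod d)\<close>, and \<open>b_n\<close> has degree \<open>n\<close> in \<open>Z\<close>. Order monomials \<open>X^i Z^j\<close>
  lexicographically with \<open>Z\<close> infinitely larger than \<open>X\<close>. The weight \<open>wt a\<close> of a nonzero element is the
  exponent of its leading monomial; it is additive on products, and on \<open>A\<close> it takes exactly the values
  of the monomials in \<open>x\<close>, \<open>y\<close>, \<open>z\<close>, where \<open>r wt x + wt y = d wt z\<close>.

  Write an exponential map as \<open>a \<mapsto> \<Sum> D n a U^n\<close>, and let \<open>u\<close> be the largest slope
  \<open>(wt (D n g) - wt g) / n\<close> for \<open>g\<close> among \<open>x\<close>, \<open>y\<close>, \<open>z\<close>. Then \<open>wt (D n a) \<le> wt a + n u\<close> for all \<open>a\<close>.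
  Keeping only the terms where equality holds gives a polynomial \<open>initial a\<close> in one variable over \<open>K\<close>.
  It is multiplicative in \<open>a\<close> and depends, up to a scalar, only on \<open>wt a\<close>. Its degree \<open>ideg a\<close> is therefore an additive
  function of the weight, and it is positive for at least one of \<open>x\<close>, \<open>y\<close>, \<open>z\<close>. The group law of the exponential map implies that
  \<open>wt a + ideg a * u\<close> is the weight of an element of \<open>ideg\<close> zero (\<open>leading_derivative\<close>).

  The relation of the weights gives \<open>r ideg x + ideg y = d ideg z\<close>, hence \<open>ideg z > 0\<close>. The main point is
  \<open>ideg x = 0\<close> (\<open>ideg_xx_0\<close>). If all three values were positive, only weight 0 would have \<open>ideg\<close> zero,
  and \<open>wt x\<close> and \<open>wt z\<close> would both be multiples of \<open>u\<close>. If \<open>ideg y = 0 < ideg x\<close>, the polynomials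
  \<open>p = initial x\<close> and \<open>q = initial z\<close> satisfy \<open>p^r = q^d\<close> with \<open>r\<close>, \<open>d\<close> coprime, so over an algebraic
  closure they are \<open>t^d\<close> and \<open>t^r\<close> up to scalars. The exponents occurring in \<open>p\<close> and \<open>q\<close> are constrained by the semigroup generated
  by \<open>r\<close> and \<open>d\<close>, which omits 1 because \<open>r, d \<ge> 2\<close>; but in one of the two powers the second
  highest term violates this constraint.

  With \<open>ideg x = 0\<close>, the slope \<open>u\<close> is negative in the direction of \<open>Z\<close>, so \<open>D n x\<close> would have negative
  degree in \<open>Z\<close> unless it vanishes. Thus \<open>x\<close> is invariant. Conversely, an invariant has \<open>ideg\<close> zero, while
  \<open>y\<close> and \<open>z\<close> have positive \<open>ideg\<close>; so it has degree 0 in \<open>Z\<close> and lies in \<open>K[x]\<close>.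
\<close>

section \<open>Ring homomorphisms out of polynomial rings\<close>

text \<open>
  Homomorphisms between rings that are types, with all elements as carrier. The three stages
  \<open>K[X]\<close>, \<open>K[X][Z]\<close>, \<open>K[X][Z][Y]\<close> of the polynomial ring and the map \<open>shear\<close> below are all
  instances of one evaluation homomorphism \<open>eval_hom h v\<close>.
\<close>

definition type_hom :: "('a::comm_ring_1 \<Rightarrow> 'b::comm_ring_1) \<Rightarrow> bool" where
  "type_hom h \<longleftrightarrow> h 0 = 0 \<and> h 1 = 1 \<and> (\<forall>a b. h (a + b) = h a + h b) \<and> (\<forall>a b. h (a * b) = h a * h b)"

lemma type_homD:
  assumes "type_hom h"
  shows "h 0 = 0" "h 1 = 1" "h (a + b) = h a + h b" "h (a * b) = h a * h b"
  using assms by (auto simp: type_hom_def)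

lemma type_hom_uminus:
  assumes "type_hom h" shows "h (- a) = - h a"
  using type_homD(1,3)[OF assms] by (metis add.inverse_unique add.right_inverse)

lemma type_hom_diff:
  assumes "type_hom h" shows "h (a - b) = h a - h b"
  using type_homD(3)[OF assms, of a "-b"] type_hom_uminus[OF assms] by simp

lemma type_hom_sum:
  assumes "type_hom h" shows "h (sum g I) = (\<Sum>i\<in>I. h (g i))"
  by (induction I rule: infinite_finite_induct) (auto simp: type_homD[OF assms])

lemma type_hom_power:
  assumes "type_hom h" shows "h (a ^ n) = h a ^ n"
  by (induction n) (auto simp: type_homD[OF assms])

definition eval_hom :: "('a::comm_ring_1 \<Rightarrow> 'b::comm_ring_1) \<Rightarrow> 'b \<Rightarrow> 'a poly \<Rightarrow> 'b" where
  "eval_hom h v p = poly (map_poly h p) v"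

lemma eval_hom_pCons:
  assumes "type_hom h" shows "eval_hom h v (pCons a p) = h a + v * eval_hom h v p"
  by (simp add: eval_hom_def map_poly_pCons type_homD[OF assms])

lemma eval_hom_0 [simp]: "eval_hom h v 0 = 0"
  by (simp add: eval_hom_def)

lemma eval_hom_add:
  assumes "type_hom h" shows "eval_hom h v (p + q) = eval_hom h v p + eval_hom h v q"
  by (induction p q rule: poly_induct2)
     (simp_all add: eval_hom_pCons[OF assms] type_homD[OF assms] algebra_simps)

lemma eval_hom_smult:
  assumes "type_hom h" shows "eval_hom h v (smult a p) = h a * eval_hom h v p"
  by (induction p) (simp_all add: eval_hom_pCons[OF assms] type_homD[OF assms] algebra_simps)

lemma eval_hom_mult:
  assumes "type_hom h" shows "eval_hom h v (p * q) = eval_hom h v p * eval_hom h v q"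
  by (induction p)
     (simp_all add: eval_hom_pCons[OF assms] eval_hom_add[OF assms] eval_hom_smult[OF assms]
        type_homD[OF assms] algebra_simps)

lemma type_hom_eval_hom:
  assumes "type_hom h" shows "type_hom (eval_hom h v)"
proof -
  have "eval_hom h v 1 = 1"
    using eval_hom_pCons[OF assms, of v 1 0] type_homD[OF assms] by (simp add: one_pCons)
  then show ?thesis
    by (simp add: type_hom_def eval_hom_add[OF assms] eval_hom_mult[OF assms])
qed

section \<open>Powers of polynomials\<close>

lemma order_power:
  fixes p :: "'k::field poly"
  assumes "p \<noteq> 0" shows "order x (p ^ n) = n * order x p"
  using assms by (induction n) (auto simp: order_mult)

text \<open>
  Compare the multiplicities of a root \<open>x\<close> of \<open>p\<close>: from \<open>r * order x p = d * order x q\<close> and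
  coprimality, \<open>order x p\<close> is a multiple of \<open>d\<close> and \<open>order x q\<close> the same multiple of \<open>r\<close>. Splitting
  off this root lowers the degree. Algebraic closedness supplies the root.
\<close>

lemma common_root_of_powers:
  fixes p q :: "'k::alg_closed_field poly"
  assumes "coprime r d" "r > 0" "d > 0" "p \<noteq> 0" "q \<noteq> 0" "c \<noteq> 0" "p ^ r = smult c (q ^ d)"
  shows "\<exists>t a b. a \<noteq> 0 \<and> b \<noteq> 0 \<and> p = smult a (t ^ d) \<and> q = smult b (t ^ r)"
  using assms(4-)
proof (induction "degree p" arbitrary: p q rule: less_induct)
  case less
  have deg: "r * degree p = d * degree q"
  proof -
    have "r * degree p = degree (p ^ r)" using less.prems(1) by (simp add: degree_power_eq)
    also have "\<dots> = d * degree q"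
      unfolding less.prems(4) using less.prems(2,3) by (simp add: degree_power_eq)
    finally show ?thesis .
  qed
  show ?case
  proof (cases "degree p = 0")
    case True
    then have "degree q = 0" using deg assms by simp
    with True obtain a b where "p = [:a:]" "q = [:b:]" by (meson degree_eq_zeroE)
    then show ?thesis using less.prems
      by (intro exI[of _ 1] exI[of _ a] exI[of _ b]) auto
  next
    case False
    then obtain x where x: "poly p x = 0" using alg_closed_imp_poly_has_root by blast
    have ord: "r * order x p = d * order x q"
    proof -
      have "r * order x p = order x (p ^ r)" using less.prems(1) by (simp add: order_power)
      also have "\<dots> = d * order x q"
        unfolding less.prems(4) using less.prems(2,3) by (simp add: order_power order_smult)
      finally show ?thesis .
    qed
    then have "d dvd order x p"
      using assms(1) by (metis coprime_commute coprime_dvd_mult_right_iff dvd_triv_left)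
    then obtain m where m: "order x p = d * m" by blast
    with ord have m': "order x q = r * m" using assms(3)
      by (metis mult.left_commute mult_left_cancel neq0_conv)
    have "m > 0" using m x less.prems(1) by (metis gr0I mult_0_right order_root)
    \<comment> \<open>Dividing \<open>p\<close> by \<open>l ^ (d * m)\<close> and \<open>q\<close> by \<open>l ^ (r * m)\<close> preserves the relation of the powers.\<close>
    define l where "l = [:-x, 1:]"
    obtain p' where p': "p = l ^ (d * m) * p'" using order_decomp[OF less.prems(1), of x] m l_def by auto
    obtain q' where q': "q = l ^ (r * m) * q'" using order_decomp[OF less.prems(2), of x] m' l_def by auto
    have l0: "l \<noteq> 0" "degree l = 1" by (auto simp: l_def)
    have nz: "p' \<noteq> 0" "q' \<noteq> 0" using less.prems p' q' by auto
    have "l ^ (d * m * r) * p' ^ r = l ^ (d * m * r) * smult c (q' ^ d)"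
      using less.prems(4) p' q' by (simp add: power_mult_distrib flip: power_mult) (simp add: mult_ac)
    then have eq: "p' ^ r = smult c (q' ^ d)" using l0 by (simp only: mult_cancel_left power_eq_0_iff) auto
    have "degree p' < degree p"
      using p' nz l0 \<open>m > 0\<close> assms by (simp add: degree_mult_eq degree_power_eq)
    from less.hyps[OF this nz less.prems(3) eq] obtain t a b
      where "a \<noteq> 0" "b \<noteq> 0" "p' = smult a (t ^ d)" "q' = smult b (t ^ r)" by blast
    then show ?thesis
      by (intro exI[of _ "l ^ m * t"] exI[of _ a] exI[of _ b])
         (simp add: p' q' power_mult_distrib flip: power_mult, simp add: mult_ac)
  qed
qed

text \<open>
  Write \<open>t = m + t'\<close> with \<open>m\<close> the leading monomial and \<open>t' \<noteq> 0\<close>, which the nonzero constant term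
  guarantees. The largest exponent of \<open>t ^ n\<close> below the top one comes from \<open>n m ^ (n - 1) t'\<close>, whose
  coefficient \<open>n\<close> survives in the field. Its distance from the top is at most \<open>degree t\<close>.
\<close>

lemma power_has_high_term:
  fixes t :: "'k::field poly"
  assumes "degree t > 0" "coeff t 0 \<noteq> 0" "of_nat n \<noteq> (0::'k)"
  shows "\<exists>i < n * degree t. coeff (t ^ n) i \<noteq> 0 \<and> n * degree t < i + 2 * degree t"
proof -
  define e where "e = degree t"
  define m where "m = monom (lead_coeff t) e"
  have n: "n > 0" using assms(3) by (cases n) auto
  have t0: "t \<noteq> 0" using assms(1) by auto
  have m: "m \<noteq> 0" "degree m = e" "lead_coeff m = lead_coeff t"
    using t0 by (auto simp: m_def degree_monom_eq)
  define s where "s = (\<Sum>i<n. m ^ (n - Suc i) * t ^ i)"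
  \<comment> \<open>The factor \<open>s\<close> is the sum of \<open>n\<close> products, all with the same leading monomial.\<close>
  have diff: "t ^ n - m ^ n = (t - m) * s" unfolding s_def by (rule power_diff_sumr2)
  have summand: "degree (m ^ (n - Suc i) * t ^ i) = (n - 1) * e"
       "lead_coeff (m ^ (n - Suc i) * t ^ i) = lead_coeff t ^ (n - 1)" if "i < n" for i
  proof -
    have "n - Suc i + i = n - 1" using that by simp
    then show "degree (m ^ (n - Suc i) * t ^ i) = (n - 1) * e"
      using m(1,2) t0 by (simp add: degree_mult_eq degree_power_eq e_def flip: add_mult_distrib)
    have "lead_coeff (m ^ (n - Suc i) * t ^ i) = lead_coeff t ^ (n - Suc i) * lead_coeff t ^ i"
      unfolding lead_coeff_mult lead_coeff_power m(3) ..
    also have "\<dots> = lead_coeff t ^ (n - 1)"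
      using \<open>n - Suc i + i = n - 1\<close> by (metis power_add)
    finally show "lead_coeff (m ^ (n - Suc i) * t ^ i) = lead_coeff t ^ (n - 1)" .
  qed
  have sc: "coeff s ((n - 1) * e) = of_nat n * lead_coeff t ^ (n - 1)"
  proof -
    have "coeff (m ^ (n - Suc i) * t ^ i) ((n - 1) * e) = lead_coeff t ^ (n - 1)" if "i < n" for i
      using summand[OF that] by metis
    then show ?thesis by (simp add: s_def coeff_sum)
  qed
  then have snz: "coeff s ((n - 1) * e) \<noteq> 0" using assms(3) t0 by simp
  have "degree s \<le> (n - 1) * e" unfolding s_def
    by (intro degree_sum_le) (use summand in auto)
  then have sdeg: "degree s = (n - 1) * e" using snz le_degree by (metis le_antisym)
  have c0: "coeff (t - m) 0 \<noteq> 0" using assms by (simp add: m_def e_def)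
  then have tm0: "t - m \<noteq> 0" by (metis coeff_0)
  have "coeff (t - m) i = 0" if "i \<ge> e" for i
    using that by (cases "i = e") (auto simp: m_def e_def coeff_eq_0)
  then have tmdeg: "degree (t - m) < e"
    by (metis leading_coeff_0_iff not_le tm0)
  define i where "i = degree (t - m) + (n - 1) * e"
  have ne: "n * e = e + (n - 1) * e" using n by (metis Suc_diff_1 mult_Suc)
  have "coeff ((t - m) * s) i = lead_coeff (t - m) * lead_coeff s"
    unfolding i_def using sdeg coeff_mult_degree_sum[of "t - m" s] by simp
  also have "\<dots> \<noteq> 0" using tm0 snz sdeg by (metis leading_coeff_0_iff mult_eq_0_iff)
  finally have "coeff (t ^ n - m ^ n) i \<noteq> 0" using diff by simp
  moreover have "coeff (m ^ n) i = 0"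
    using tmdeg ne by (simp add: m_def monom_power i_def mult.commute)
  ultimately show ?thesis using tmdeg ne assms(1)
    by (intro exI[of _ i]) (simp add: i_def e_def)
qed

lemma type_hom_map_poly_to_ac: "type_hom (map_poly to_ac :: 'k::field poly \<Rightarrow> _)"
proof -
  have "map_poly to_ac (p * q) = map_poly to_ac p * map_poly to_ac q" for p q :: "'k poly"
    by (intro poly_eqI) (simp add: coeff_map_poly coeff_mult to_ac_sum)
  moreover have "map_poly to_ac (p + q) = map_poly to_ac p + map_poly to_ac q" for p q :: "'k poly"
    by (intro poly_eqI) (simp add: coeff_map_poly)
  ultimately show ?thesis by (simp add: type_hom_def)
qed

text \<open>
  Parametrizing the cusp \<open>p ^ r = q ^ d\<close> gives \<open>p = a t ^ d\<close> and \<open>q = b t ^ r\<close> with \<open>degree t = e\<close>.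
  The exponents \<open>d\<close> and \<open>r\<close> are coprime, so at least one of them is nonzero in the field, and the
  corresponding power of \<open>t\<close> has a term less than \<open>2 * e\<close> below its top term.
\<close>

lemma no_gapped_cusp:
  fixes p q :: "'k::field poly"
  assumes "coprime r d" "r > 0" "d > 0" "e > 0" "p ^ r = q ^ d" "coeff p 0 \<noteq> 0"
    and deg: "degree p = d * e" "degree q = r * e"
    and gap: "\<And>i. coeff p i \<noteq> 0 \<Longrightarrow> i < d * e \<Longrightarrow> i + 2 * e \<le> d * e"
             "\<And>i. coeff q i \<noteq> 0 \<Longrightarrow> i < r * e \<Longrightarrow> i + 2 * e \<le> r * e"
  shows False
proof -
  define P where "P = map_poly to_ac p"
  define Q where "Q = map_poly to_ac q"
  note hom = type_hom_map_poly_to_ac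
  have pq: "p \<noteq> 0" "q \<noteq> 0" using deg assms by auto
  have PQ: "P \<noteq> 0" "Q \<noteq> 0"
    using pq by (auto simp: P_def Q_def poly_eq_iff coeff_map_poly)
  have "P ^ r = smult 1 (Q ^ d)"
    using arg_cong[OF assms(5), of "map_poly to_ac"] by (simp add: type_hom_power[OF hom] P_def Q_def)
  from common_root_of_powers[OF assms(1-3) PQ _ this] obtain t a b
    where t: "a \<noteq> 0" "b \<noteq> 0" "P = smult a (t ^ d)" "Q = smult b (t ^ r)" by auto
  have dP: "degree P = d * e" using deg by (simp add: P_def degree_map_poly)
  have "t \<noteq> 0" using t PQ assms(3) by auto
  then have te: "degree t = e" using dP t assms(3) by (simp add: degree_power_eq)
  have "coeff P 0 \<noteq> 0" using assms(6) by (simp add: P_def coeff_map_poly)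
  then have t0: "coeff t 0 \<noteq> 0" using t assms(3) by (metis coeff_0_power coeff_smult mult_eq_0_iff power_eq_0_iff)
  have "\<not> (of_nat d = (0 :: 'k alg_closure) \<and> of_nat r = (0 :: 'k alg_closure))"
  proof
    assume "of_nat d = (0 :: 'k alg_closure) \<and> of_nat r = (0 :: 'k alg_closure)"
    then have "CHAR('k alg_closure) dvd d" "CHAR('k alg_closure) dvd r"
      by (auto simp: of_nat_eq_0_iff_char_dvd)
    then show False using assms(1) by (metis CHAR_not_1' coprime_common_divisor_nat One_nat_def)
  qed
  then consider "of_nat d \<noteq> (0 :: 'k alg_closure)" | "of_nat r \<noteq> (0 :: 'k alg_closure)" by blast
  then show False
  proof cases
    case 1
    from power_has_high_term[OF _ t0 this] te assms(4) obtain i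
      where i: "i < d * e" "coeff (t ^ d) i \<noteq> 0" "d * e < i + 2 * e" by auto
    then have "coeff P i \<noteq> 0" using t by simp
    then show False using gap(1)[of i] i by (simp add: P_def coeff_map_poly)
  next
    case 2
    from power_has_high_term[OF _ t0 this] te assms(4) obtain i
      where i: "i < r * e" "coeff (t ^ r) i \<noteq> 0" "r * e < i + 2 * e" by auto
    then have "coeff Q i \<noteq> 0" using t by simp
    then show False using gap(2)[of i] i by (simp add: Q_def coeff_map_poly)
  qed
qed

section \<open>Leading terms\<close>

text \<open>
  In the field of Laurent series in \<open>1/X\<close>, the negative of \<open>fls_subdegree\<close> is the degree in \<open>X\<close>.
  The value \<open>[:i, j:]\<close> stands for the monomial \<open>X^i Z^j\<close>; since \<open>rat poly\<close> is ordered by leading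
  coefficients, \<open>wt\<close> is the exponent of the leading monomial for the lexicographic order in which \<open>Z\<close>
  is infinitely larger than \<open>X\<close>. Rational coefficients leave room for the slopes introduced below.
\<close>

definition wt :: "'k::field fls poly \<Rightarrow> rat poly" where
  "wt g = [:- of_int (fls_subdegree (lead_coeff g)), of_nat (degree g):]"

definition lc :: "'k::field fls poly \<Rightarrow> 'k" where
  "lc g = fls_nth (lead_coeff g) (fls_subdegree (lead_coeff g))"

definition wt_le :: "'k::field fls poly \<Rightarrow> rat poly \<Rightarrow> bool" where
  "wt_le g \<gamma> \<longleftrightarrow> g = 0 \<or> wt g \<le> \<gamma>"

text \<open>
  On the elements with \<open>wt_le g \<gamma>\<close> this is the projection to the graded piece of weight \<open>\<gamma>\<close>. A graded
  piece is at most one-dimensional over \<open>K\<close>, so its elements are recorded by a scalar.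
\<close>

definition top_coeff :: "rat poly \<Rightarrow> 'k::field fls poly \<Rightarrow> 'k" where
  "top_coeff \<gamma> g = (if g \<noteq> 0 \<and> wt g = \<gamma> then lc g else 0)"

abbreviation scal :: "'k::field \<Rightarrow> 'k fls poly" where
  "scal c \<equiv> [:fls_const c:]"

lemma lex_less_iff:
  fixes a b a' b' :: rat
  shows "[:a, b:] < [:a', b':] \<longleftrightarrow> b < b' \<or> b = b' \<and> a < a'"
  by (auto simp: less_poly_def pos_poly_def)

lemma lex_le_iff:
  fixes a b a' b' :: rat
  shows "[:a, b:] \<le> [:a', b':] \<longleftrightarrow> b < b' \<or> b = b' \<and> a \<le> a'"
  using lex_less_iff[of a b a' b'] by (auto simp: order.order_iff_strict)

lemma lc_nonzero: "g \<noteq> 0 \<Longrightarrow> lc g \<noteq> 0"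
  by (simp add: lc_def)

lemma wt_mult: "a \<noteq> 0 \<Longrightarrow> b \<noteq> 0 \<Longrightarrow> wt (a * b) = wt a + wt b"
  unfolding wt_def lead_coeff_mult by (simp add: degree_mult_eq)

lemma lc_mult: "a \<noteq> 0 \<Longrightarrow> b \<noteq> 0 \<Longrightarrow> lc (a * b) = lc a * lc b"
  unfolding lc_def lead_coeff_mult by simp

lemma wt_one [simp]: "wt 1 = 0"
  by (simp add: wt_def)

lemma lc_one [simp]: "lc 1 = 1"
  by (simp add: lc_def)

lemma wt_power: "a \<noteq> 0 \<Longrightarrow> wt (a ^ n) = of_nat n * wt a"
  by (induction n) (auto simp: wt_mult algebra_simps)

lemma lc_power: "a \<noteq> 0 \<Longrightarrow> lc (a ^ n) = lc a ^ n"
  by (induction n) (auto simp: lc_mult)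

text \<open>
  This description by vanishing coefficients makes the behaviour under sums evident, whereas the
  definition by leading terms is the one suited to products.
\<close>

lemma wt_le_iff_coeffs:
  "wt_le g [:- of_int m, of_nat n:] \<longleftrightarrow>
     (\<forall>i>n. coeff g i = 0) \<and> (\<forall>j<m. fls_nth (coeff g n) j = 0)"
proof (cases "g = 0")
  case False
  show ?thesis
  proof
    assume "wt_le g [:- of_int m, of_nat n:]"
    then have "degree g < n \<or> degree g = n \<and> m \<le> fls_subdegree (lead_coeff g)"
      using False by (simp add: wt_le_def wt_def lex_le_iff)
    then show "(\<forall>i>n. coeff g i = 0) \<and> (\<forall>j<m. fls_nth (coeff g n) j = 0)"
      by (auto simp: coeff_eq_0)
  next
    assume *: "(\<forall>i>n. coeff g i = 0) \<and> (\<forall>j<m. fls_nth (coeff g n) j = 0)"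
    then have "degree g \<le> n" using degree_le by blast
    moreover have "m \<le> fls_subdegree (lead_coeff g)" if "degree g = n"
      using * that False by (intro fls_subdegree_geI) auto
    ultimately show "wt_le g [:- of_int m, of_nat n:]"
      by (auto simp: wt_le_def wt_def lex_le_iff)
  qed
qed (simp add: wt_le_def)

lemma top_coeff_eq_coeff:
  assumes "wt_le g [:- of_int m, of_nat n:]"
  shows "top_coeff [:- of_int m, of_nat n:] g = fls_nth (coeff g n) m"
proof (cases "g = 0")
  case False
  with assms have "degree g < n \<or> degree g = n \<and> m \<le> fls_subdegree (lead_coeff g)"
    by (simp add: wt_le_def wt_def lex_le_iff)
  then show ?thesis using False
    by (auto simp: top_coeff_def wt_def lc_def coeff_eq_0 order.order_iff_strict)
qed (simp add: top_coeff_def)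

lemma wt_form: "\<exists>m n. wt g = [:- of_int m, of_nat n:]"
  by (auto simp: wt_def)

lemma wt_le_refl: "wt_le a (wt a)"
  by (simp add: wt_le_def)

lemma wt_le_0 [simp]: "wt_le 0 \<gamma>"
  by (simp add: wt_le_def)

lemma wt_le_trans: "wt_le a \<gamma> \<Longrightarrow> \<gamma> \<le> \<gamma>' \<Longrightarrow> wt_le a \<gamma>'"
  by (auto simp: wt_le_def)

lemma top_coeff_0 [simp]: "top_coeff \<gamma> 0 = 0"
  by (simp add: top_coeff_def)

lemma top_coeff_wt: "a \<noteq> 0 \<Longrightarrow> top_coeff (wt a) a = lc a"
  by (simp add: top_coeff_def)

lemma top_coeff_below: "wt_le a \<gamma> \<Longrightarrow> \<gamma> < \<gamma>' \<Longrightarrow> top_coeff \<gamma>' a = 0"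
  by (auto simp: wt_le_def top_coeff_def)

lemma top_coeff_eq_0_iff: "top_coeff \<gamma> a = 0 \<longleftrightarrow> a = 0 \<or> wt a \<noteq> \<gamma>"
  by (auto simp: top_coeff_def lc_nonzero)

lemma wt_le_top_coeff_0: "wt_le a \<gamma> \<Longrightarrow> top_coeff \<gamma> a = 0 \<Longrightarrow> a = 0 \<or> wt a < \<gamma>"
  by (auto simp: wt_le_def top_coeff_eq_0_iff)

lemma wt_le_add_form:
  assumes "wt_le a [:- of_int m, of_nat n:]" "wt_le b [:- of_int m, of_nat n:]"
  shows "wt_le (a + b) [:- of_int m, of_nat n:]"
  using assms by (simp add: wt_le_iff_coeffs)

lemma wt_le_add:
  assumes "wt_le a \<gamma>" "wt_le b \<gamma>"
  shows "wt_le (a + b) \<gamma>"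
proof (cases "a = 0 \<or> b = 0")
  case False
  define \<delta> where "\<delta> = max (wt a) (wt b)"
  have "wt_le (a + b) \<delta>"
  proof -
    obtain m n where "\<delta> = [:- of_int m, of_nat n:]"
      using wt_form unfolding \<delta>_def max_def by metis
    moreover have "wt_le a \<delta>" "wt_le b \<delta>" by (auto simp: wt_le_def \<delta>_def)
    ultimately show ?thesis using wt_le_add_form by metis
  qed
  moreover have "\<delta> \<le> \<gamma>" using assms False by (auto simp: \<delta>_def wt_le_def)
  ultimately show ?thesis by (rule wt_le_trans)
qed (use assms in auto)

text \<open>
  A weight that does not come from a monomial is the weight of no element, and then all three
  coefficients vanish.
\<close>

lemma top_coeff_add:
  assumes "wt_le a \<gamma>" "wt_le b \<gamma>"
  shows "top_coeff \<gamma> (a + b) = top_coeff \<gamma> a + top_coeff \<gamma> b"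
proof (cases "\<exists>m n. \<gamma> = [:- of_int m, of_nat n:]")
  case True
  then obtain m n where \<gamma>: "\<gamma> = [:- of_int m, of_nat n:]" by blast
  show ?thesis
    using top_coeff_eq_coeff[of a m n] top_coeff_eq_coeff[of b m n] top_coeff_eq_coeff[of "a + b" m n]
      assms wt_le_add[OF assms] unfolding \<gamma> by simp
next
  case False
  then have "wt g \<noteq> \<gamma>" for g :: "'a fls poly" using wt_form by metis
  then show ?thesis by (simp add: top_coeff_def)
qed

lemma wt_le_sum:
  assumes "\<And>i. i \<in> I \<Longrightarrow> wt_le (g i) \<gamma>"
  shows "wt_le (sum g I) \<gamma>"
  using assms by (induction I rule: infinite_finite_induct) (auto intro: wt_le_add)

lemma top_coeff_sum:
  assumes "\<And>i. i \<in> I \<Longrightarrow> wt_le (g i) \<gamma>"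
  shows "top_coeff \<gamma> (sum g I) = (\<Sum>i\<in>I. top_coeff \<gamma> (g i))"
  using assms by (induction I rule: infinite_finite_induct) (auto simp: top_coeff_add wt_le_sum)

lemma wt_le_mult: "wt_le a \<gamma> \<Longrightarrow> wt_le b \<delta> \<Longrightarrow> wt_le (a * b) (\<gamma> + \<delta>)"
  using wt_mult[of a b] by (cases "a = 0 \<or> b = 0") (auto simp: wt_le_def add_mono)

lemma top_coeff_mult:
  assumes "wt_le a \<gamma>" "wt_le b \<delta>"
  shows "top_coeff (\<gamma> + \<delta>) (a * b) = top_coeff \<gamma> a * top_coeff \<delta> b"
proof (cases "a = 0 \<or> b = 0 \<or> wt a = \<gamma> \<and> wt b = \<delta>")
  case True
  then show ?thesis by (auto simp: top_coeff_def wt_mult lc_mult)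
next
  case False
  then have "wt a < \<gamma> \<or> wt b < \<delta>" "wt a \<le> \<gamma>" "wt b \<le> \<delta>"
    using assms by (auto simp: wt_le_def)
  then have "wt a + wt b < \<gamma> + \<delta>" by (auto intro: add_less_le_mono add_le_less_mono)
  then have "top_coeff (\<gamma> + \<delta>) (a * b) = 0" using False by (simp add: top_coeff_def wt_mult)
  then show ?thesis using False by (auto simp: top_coeff_def)
qed

lemma wt_scal [simp]: "wt (scal c) = 0"
  by (simp add: wt_def)

lemma lc_scal [simp]: "lc (scal c) = c"
  by (simp add: lc_def)

lemma wt_smult: "c \<noteq> 0 \<Longrightarrow> wt (smult (fls_const c) a) = wt a"
  by (cases "a = 0") (use wt_mult[of "scal c" a] in auto)

lemma lc_smult: "c \<noteq> 0 \<Longrightarrow> a \<noteq> 0 \<Longrightarrow> lc (smult (fls_const c) a) = c * lc a"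
  using lc_mult[of "scal c" a] by simp

lemma top_coeff_smult: "top_coeff \<gamma> (smult (fls_const c) a) = c * top_coeff \<gamma> a"
  by (cases "c = 0") (auto simp: top_coeff_def wt_smult lc_smult)

lemma wt_le_smult: "wt_le a \<gamma> \<Longrightarrow> wt_le (smult (fls_const c) a) \<gamma>"
  by (cases "c = 0") (auto simp: wt_le_def wt_smult)

section \<open>Iterative higher derivations and their initial forms\<close>

text \<open>
  The coefficient functions \<open>a \<mapsto> D n a\<close> of an exponential map, transported to a subring of
  \<open>K((1/X))[Z]\<close>. The rule \<open>D_comp\<close> is the group law \<open>\<phi>_V \<circ> \<phi>_U = \<phi>_(V+U)\<close> read off coefficientwise;
  with its binomial coefficients it is meaningful in every characteristic.
\<close>

locale higher_derivation =
  fixes A :: "'k::field fls poly set" and D :: "nat \<Rightarrow> 'k fls poly \<Rightarrow> 'k fls poly"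
  assumes scal_mem: "scal c \<in> A"
    and add_mem: "a \<in> A \<Longrightarrow> b \<in> A \<Longrightarrow> a + b \<in> A"
    and mult_mem: "a \<in> A \<Longrightarrow> b \<in> A \<Longrightarrow> a * b \<in> A"
    and D_mem: "a \<in> A \<Longrightarrow> D n a \<in> A"
    and D_zero: "a \<in> A \<Longrightarrow> D 0 a = a"
    and D_add: "a \<in> A \<Longrightarrow> b \<in> A \<Longrightarrow> D n (a + b) = D n a + D n b"
    and D_mult: "a \<in> A \<Longrightarrow> b \<in> A \<Longrightarrow> D n (a * b) = (\<Sum>i\<le>n. D i a * D (n - i) b)"
    and D_scal: "n > 0 \<Longrightarrow> D n (scal c) = 0"
    and D_finite: "a \<in> A \<Longrightarrow> \<exists>N. \<forall>n>N. D n a = 0"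
    and D_comp: "a \<in> A \<Longrightarrow> D j (D i a) = of_nat ((i + j) choose i) * D (i + j) a"
begin

lemma power_mem: "a \<in> A \<Longrightarrow> a ^ n \<in> A"
  using scal_mem[of 1] by (induction n) (auto simp: mult_mem one_pCons)

lemma smult_mem: "a \<in> A \<Longrightarrow> smult (fls_const c) a \<in> A"
  using mult_mem[OF scal_mem[of c]] by simp

lemma D_smult:
  assumes "a \<in> A" shows "D n (smult (fls_const c) a) = smult (fls_const c) (D n a)"
proof -
  have "D n (scal c * a) = (\<Sum>i\<le>n. D i (scal c) * D (n - i) a)"
    by (rule D_mult[OF scal_mem assms])
  also have "\<dots> = (\<Sum>i\<in>{0}. D i (scal c) * D (n - i) a)"
    by (rule sum.mono_neutral_right) (auto simp: D_scal)
  finally show ?thesis by (simp add: D_zero scal_mem)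
qed

lemma D_at_0: "D n 0 = 0"
  using D_smult[of "scal 0" n 0] scal_mem[of 0] by simp

lemma constant_mult:
  assumes "a \<in> A" "b \<in> A" "\<forall>n>0. D n a = 0" "\<forall>n>0. D n b = 0"
  shows "\<forall>n>0. D n (a * b) = 0"
proof (intro allI impI)
  fix n :: nat assume "n > 0"
  have "D i a * D (n - i) b = 0" for i
    using assms(3,4) \<open>n > 0\<close> by (cases "i = 0") auto
  then have "(\<Sum>i\<le>n. D i a * D (n - i) b) = 0" by (intro sum.neutral) blast
  then show "D n (a * b) = 0" by (simp add: D_mult assms(1,2))
qed

lemma constant_add:
  assumes "a \<in> A" "b \<in> A" "\<forall>n>0. D n a = 0" "\<forall>n>0. D n b = 0"
  shows "\<forall>n>0. D n (a + b) = 0"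
  using assms by (simp add: D_add)

end

text \<open>
  Give the indeterminate of the exponential map the weight \<open>-u\<close>. The assumption says that the map
  respects the filtration by weight, so it has a homogeneous part on the associated graded ring.
  That part is an exponential map again, and it is nontrivial when the bound is attained for some
  positive \<open>i\<close>.
\<close>

locale sloped_derivation = higher_derivation +
  fixes u :: "rat poly"
  assumes slope: "a \<in> A \<Longrightarrow> a \<noteq> 0 \<Longrightarrow> wt_le (D i a) (wt a + of_nat i * u)"
begin

text \<open>
  The homogeneous part of the exponential map sends the leading monomial \<open>M\<close> of \<open>a\<close> to a sum of
  scalar multiples of monomials of weight \<open>wt M + i u\<close>, one for each power \<open>U^i\<close>. These scalars are
  collected in a polynomial in one variable; no graded ring has to be constructed.
\<close>

definition initial :: "'a fls poly \<Rightarrow> 'a poly" where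
  "initial a = Abs_poly (\<lambda>i. top_coeff (wt a + of_nat i * u) (D i a))"

definition ideg :: "'a fls poly \<Rightarrow> nat" where
  "ideg a = degree (initial a)"

lemma coeff_initial:
  assumes "a \<in> A"
  shows "coeff (initial a) i = top_coeff (wt a + of_nat i * u) (D i a)"
proof -
  obtain N where "\<forall>n>N. D n a = 0" using D_finite[OF assms] by blast
  then show ?thesis unfolding initial_def by (subst coeff_Abs_poly[of N]) auto
qed

lemma coeff_0_initial: "a \<in> A \<Longrightarrow> a \<noteq> 0 \<Longrightarrow> coeff (initial a) 0 = lc a"
  by (simp add: coeff_initial D_zero top_coeff_wt)

lemma initial_nonzero: "a \<in> A \<Longrightarrow> a \<noteq> 0 \<Longrightarrow> initial a \<noteq> 0"
  using coeff_0_initial lc_nonzero by (metis coeff_0)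

lemma initial_mult:
  assumes "a \<in> A" "b \<in> A" "a \<noteq> 0" "b \<noteq> 0"
  shows "initial (a * b) = initial a * initial b"
proof (rule poly_eqI)
  fix n
  have split: "wt (a * b) + of_nat n * u
      = (wt a + of_nat i * u) + (wt b + of_nat (n - i) * u)" if "i \<le> n" for i
    using that assms by (simp add: wt_mult of_nat_diff algebra_simps)
  have "coeff (initial (a * b)) n = top_coeff (wt (a * b) + of_nat n * u) (\<Sum>i\<le>n. D i a * D (n - i) b)"
    using assms by (simp add: coeff_initial mult_mem D_mult)
  also have "\<dots> = (\<Sum>i\<le>n. top_coeff (wt (a * b) + of_nat n * u) (D i a * D (n - i) b))"
  proof (rule top_coeff_sum)
    fix i assume "i \<in> {..n}"
    then show "wt_le (D i a * D (n - i) b) (wt (a * b) + of_nat n * u)"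
      using assms by (simp only: atMost_iff split) (intro wt_le_mult slope)
  qed
  also have "\<dots> = (\<Sum>i\<le>n. coeff (initial a) i * coeff (initial b) (n - i))"
  proof (rule sum.cong)
    fix i assume "i \<in> {..n}"
    then have "i \<le> n" by simp
    show "top_coeff (wt (a * b) + of_nat n * u) (D i a * D (n - i) b)
        = coeff (initial a) i * coeff (initial b) (n - i)"
      unfolding split[OF \<open>i \<le> n\<close>] using assms
      by (simp only: coeff_initial) (intro top_coeff_mult slope)
  qed simp
  finally show "coeff (initial (a * b)) n = coeff (initial a * initial b) n"
    by (simp add: coeff_mult)
qed

lemma initial_one: "initial 1 = 1"
proof (rule poly_eqI)
  fix n
  have one: "scal (1::'a) = 1" by (simp add: one_pCons)
  have "1 \<in> A" using scal_mem[of 1] unfolding one .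
  moreover have "D n 1 = 0" if "n > 0" using D_scal[OF that, of 1] unfolding one .
  ultimately show "coeff (initial 1) n = coeff 1 n"
    by (cases "n = 0") (simp_all add: coeff_initial D_zero top_coeff_def)
qed

lemma initial_power: "a \<in> A \<Longrightarrow> a \<noteq> 0 \<Longrightarrow> initial (a ^ n) = initial a ^ n"
  by (induction n) (simp_all add: initial_mult initial_one power_mem)

text \<open>
  The combination \<open>lc b * a - lc a * b\<close> has lost its leading term, so its derivatives do not reach
  the weights that enter \<open>initial\<close>. Hence \<open>ideg\<close> is a function of the weight alone, and
  by multiplicativity an additive one.
\<close>

lemma initial_eq_of_wt_eq:
  assumes "a \<in> A" "b \<in> A" "a \<noteq> 0" "b \<noteq> 0" "wt a = wt b"
  shows "smult (lc b) (initial a) = smult (lc a) (initial b)"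
proof (rule poly_eqI)
  fix i
  define c where "c = smult (fls_const (lc b)) a + smult (fls_const (- lc a)) b"
  have cA: "c \<in> A" using assms by (simp add: c_def smult_mem add_mem del: fls_const_uminus)
  define \<gamma> where "\<gamma> = wt a + of_nat i * u"
  have "wt_le c (wt a)" unfolding c_def
    using wt_le_add wt_le_smult wt_le_refl assms(5) by metis
  moreover have "top_coeff (wt a) c = 0"
  proof -
    have "top_coeff (wt a) a = lc a" "top_coeff (wt a) b = lc b"
      using top_coeff_wt[OF assms(3)] top_coeff_wt[OF assms(4)] assms(5) by simp_all
    moreover have "wt_le (smult (fls_const (lc b)) a) (wt a)" "wt_le (smult (fls_const (- lc a)) b) (wt a)"
      using wt_le_smult wt_le_refl assms(5) by metis+
    ultimately show ?thesis
      unfolding c_def by (simp only: top_coeff_add top_coeff_smult) simp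
  qed
  ultimately have "c = 0 \<or> wt c < wt a" by (rule wt_le_top_coeff_0)
  then have "top_coeff \<gamma> (D i c) = 0"
  proof
    assume "wt c < wt a"
    show ?thesis
    proof (cases "c = 0")
      case False
      show ?thesis
        using top_coeff_below[OF slope[OF cA False, of i], of \<gamma>] \<open>wt c < wt a\<close> by (simp add: \<gamma>_def)
    qed (simp add: D_at_0)
  qed (simp add: D_at_0)
  moreover have "D i c = smult (fls_const (lc b)) (D i a) + smult (fls_const (- lc a)) (D i b)"
    unfolding c_def using assms by (simp only: D_add D_smult smult_mem)
  moreover have "wt_le (D i a) \<gamma>" "wt_le (D i b) \<gamma>"
    using slope[OF assms(1,3), of i] slope[OF assms(2,4), of i] assms(5) by (auto simp: \<gamma>_def)
  ultimately have "lc b * top_coeff \<gamma> (D i a) + (- lc a) * top_coeff \<gamma> (D i b) = 0"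
    by (metis top_coeff_add top_coeff_smult wt_le_smult)
  then show "coeff (smult (lc b) (initial a)) i = coeff (smult (lc a) (initial b)) i"
    using assms by (simp add: coeff_initial \<gamma>_def)
qed

lemma ideg_eq_of_wt_eq:
  assumes "a \<in> A" "b \<in> A" "a \<noteq> 0" "b \<noteq> 0" "wt a = wt b"
  shows "ideg a = ideg b"
  using arg_cong[OF initial_eq_of_wt_eq[OF assms], of degree] lc_nonzero[OF assms(3)] lc_nonzero[OF assms(4)]
  by (simp add: ideg_def)

lemma ideg_mult:
  "a \<in> A \<Longrightarrow> b \<in> A \<Longrightarrow> a \<noteq> 0 \<Longrightarrow> b \<noteq> 0 \<Longrightarrow> ideg (a * b) = ideg a + ideg b"
  by (simp add: ideg_def initial_mult degree_mult_eq initial_nonzero)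

lemma ideg_power: "a \<in> A \<Longrightarrow> a \<noteq> 0 \<Longrightarrow> ideg (a ^ n) = n * ideg a"
  by (simp add: ideg_def initial_power degree_power_eq initial_nonzero)

lemma wt_of_coeff_initial:
  assumes "a \<in> A" "coeff (initial a) i \<noteq> 0"
  shows "D i a \<noteq> 0" "wt (D i a) = wt a + of_nat i * u"
  using assms by (auto simp: coeff_initial top_coeff_eq_0_iff)

text \<open>
  The coefficient of the highest power of \<open>U\<close> in an exponential map is invariant: iterating \<open>D\<close> on it
  produces a multiple of a later coefficient, and there is none. The homogeneous part inherits this,
  so from every weight of the subring one arrives at a weight of \<open>ideg\<close> zero by adding \<open>ideg\<close> times \<open>u\<close>.
\<close>

lemma leading_derivative:
  assumes "a \<in> A" "a \<noteq> 0"
  defines "b \<equiv> D (ideg a) a"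
  shows "b \<in> A" "b \<noteq> 0" "wt b = wt a + of_nat (ideg a) * u" "ideg b = 0"
proof -
  have "coeff (initial a) (ideg a) \<noteq> 0"
    using initial_nonzero[OF assms(1,2)] by (simp add: ideg_def)
  note w = wt_of_coeff_initial[OF assms(1) this]
  show b: "b \<in> A" "b \<noteq> 0" "wt b = wt a + of_nat (ideg a) * u"
    using w assms(1) by (auto simp: b_def D_mem)
  have "coeff (initial b) j = 0" if "j > 0" for j
  proof -
    define k where "k = ideg a + j"
    define c where "c = (of_nat (k choose ideg a) :: 'a)"
    have "D j b = smult (fls_const c) (D k a)"
      unfolding b_def D_comp[OF assms(1)] c_def k_def
      by (simp add: fls_of_nat of_nat_poly)
    moreover have "wt b + of_nat j * u = wt a + of_nat k * u"
      by (simp add: b k_def algebra_simps)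
    ultimately have "coeff (initial b) j = c * coeff (initial a) k"
      using b(1) assms(1) by (simp add: coeff_initial top_coeff_smult)
    also have "coeff (initial a) k = 0"
      using that by (simp add: k_def ideg_def coeff_eq_0)
    finally show ?thesis by simp
  qed
  then have "degree (initial b) \<le> 0" by (intro degree_le) auto
  then show "ideg b = 0" by (simp add: ideg_def)
qed

end

section \<open>The surface inside \<open>K((1/X))[Z]\<close>\<close>

text \<open>
  The variable \<open>X\<close> goes to \<open>fls_X_inv\<close>, so that the subdegree of a series measures the growth at infinity.
\<close>

definition emb :: "'k::field poly \<Rightarrow> 'k fls" where
  "emb = eval_hom fls_const fls_X_inv"

lemma type_hom_fls_const: "type_hom (fls_const :: 'k::field \<Rightarrow> 'k fls)"
  by (simp add: type_hom_def fls_plus_const)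

lemma type_hom_emb: "type_hom emb"
  unfolding emb_def by (rule type_hom_eval_hom[OF type_hom_fls_const])

lemma emb_pCons: "emb (pCons c p) = fls_const c + fls_X_inv * emb p"
  unfolding emb_def by (rule eval_hom_pCons[OF type_hom_fls_const])

lemma emb_0 [simp]: "emb 0 = 0"
  using type_homD(1)[OF type_hom_emb] .

lemma emb_1 [simp]: "emb 1 = 1"
  using type_homD(2)[OF type_hom_emb] .

lemma nth_emb: "fls_nth (emb p) j = (if j \<le> 0 then coeff p (nat (- j)) else 0)"
proof (induction p arbitrary: j)
  case (pCons c p)
  show ?case
  proof (cases "j < 0")
    case True
    then have "nat (- j) = Suc (nat (- (j + 1)))" by simp
    then show ?thesis using True
      by (simp add: emb_pCons fls_X_inv_times_conv_shift pCons.IH add.commute)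
  qed (auto simp: emb_pCons fls_X_inv_times_conv_shift pCons.IH)
qed simp

lemma emb_eq_0_iff [simp]: "emb p = 0 \<longleftrightarrow> p = 0"
proof
  assume "emb p = 0"
  then have "coeff p n = 0" for n using nth_emb[of p "- int n"] by simp
  then show "p = 0" by (simp add: poly_eq_iff)
qed simp

lemma subdegree_emb: "fls_subdegree (emb p) = - int (degree p)"
proof (cases "p = 0")
  case False
  show ?thesis
    by (rule fls_subdegree_eqI) (use False in \<open>auto simp: nth_emb coeff_eq_0\<close>)
qed simp

lemma base_emb: "fls_nth (emb p) (fls_subdegree (emb p)) = lead_coeff p"
  by (simp add: subdegree_emb nth_emb)

lemma type_hom_const_emb: "type_hom (\<lambda>p. [:emb p:])"
  using type_hom_emb by (auto simp: type_hom_def one_pCons)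

definition emb_Z :: "'k::field poly poly \<Rightarrow> 'k fls poly" where
  "emb_Z = eval_hom (\<lambda>p. [:emb p:]) [:0, 1:]"

lemma type_hom_emb_Z: "type_hom emb_Z"
  unfolding emb_Z_def by (rule type_hom_eval_hom[OF type_hom_const_emb])

lemma emb_Z_0 [simp]: "emb_Z 0 = 0"
  by (simp add: emb_Z_def)

lemma emb_Z_pCons [simp]: "emb_Z (pCons a p) = pCons (emb a) (emb_Z p)"
  unfolding emb_Z_def by (simp add: eval_hom_pCons[OF type_hom_const_emb])

lemma coeff_emb_Z: "coeff (emb_Z p) n = emb (coeff p n)"
  by (induction p arbitrary: n) (auto simp: coeff_pCons split: nat.split)

lemma degree_emb_Z: "degree (emb_Z p) = degree p"
proof (rule antisym)
  show "degree (emb_Z p) \<le> degree p" by (rule degree_le) (simp add: coeff_emb_Z coeff_eq_0)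
  show "degree p \<le> degree (emb_Z p)"
    by (cases "p = 0") (auto intro!: le_degree simp: coeff_emb_Z)
qed

locale surface =
  fixes r d :: nat and f :: "'k::field poly" and \<phi> :: "'k poly poly"
  assumes r: "r \<ge> 2" and d: "d \<ge> 2"
    and f: "degree f = r" "lead_coeff f = 1"
    and \<phi>: "degree \<phi> = d" "lead_coeff \<phi> = 1"
begin

abbreviation xx :: "'k fls poly" where "xx \<equiv> [:fls_X_inv:]"
abbreviation zz :: "'k fls poly" where "zz \<equiv> [:0, 1:]"

definition yy :: "'k fls poly" where
  "yy = smult (inverse (emb f)) (emb_Z \<phi>)"

definition ev :: "'k poly poly poly \<Rightarrow> 'k fls poly" where
  "ev = eval_hom emb_Z yy"

definition rel :: "'k poly poly poly" where
  "rel = [:[:f:]:] * [:0, 1:] - [:\<phi>:]"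

text \<open>
  The monomials \<open>Y^q Z^i\<close> with \<open>i < d\<close>, enumerated by \<open>n = q * d + i\<close>. They form a basis of the coordinate
  ring over \<open>K[X]\<close>, and the image of \<open>basis n\<close> has degree exactly \<open>n\<close> in \<open>Z\<close>.
\<close>

definition basis :: "nat \<Rightarrow> 'k poly poly poly" where
  "basis n = [:0, 1:] ^ (n div d) * [:[:0, 1:]:] ^ (n mod d)"

lemma f_nonzero: "f \<noteq> 0" and \<phi>_nonzero: "\<phi> \<noteq> 0"
  using f \<phi> r d by auto

lemma type_hom_ev: "type_hom ev"
  unfolding ev_def by (rule type_hom_eval_hom[OF type_hom_emb_Z])

lemma ev_const: "ev [:p:] = emb_Z p"
  by (simp add: ev_def eval_hom_pCons[OF type_hom_emb_Z])

lemma ev_X: "ev [:[:p:]:] = [:emb p:]"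
  by (simp add: ev_const)

lemma ev_Y: "ev [:0, 1:] = yy"
  by (simp add: ev_def eval_hom_pCons[OF type_hom_emb_Z] type_homD[OF type_hom_emb_Z])

lemma ev_Z: "ev [:[:0, 1:]:] = zz"
  by (simp add: ev_const)

lemma relation: "[:emb f:] * yy = emb_Z \<phi>"
  using f_nonzero by (simp add: yy_def)

lemma ev_rel: "ev rel = 0"
  using relation
  by (simp only: rel_def type_hom_diff[OF type_hom_ev] type_homD[OF type_hom_ev] ev_X ev_Y ev_const)
     simp

lemma degree_yy: "degree yy = d" and lead_coeff_yy: "lead_coeff yy = inverse (emb f)"
  using f_nonzero \<phi> by (simp_all add: yy_def degree_emb_Z coeff_emb_Z)

lemma yy_nonzero: "yy \<noteq> 0"
  using degree_yy d by auto

subsection \<open>Normal forms\<close>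

text \<open>
  Polynomials that are congruent to a \<open>K[X]\<close>-combination of basis monomials modulo the relation of the
  surface. Closure under multiplication by \<open>X\<close>, \<open>Y\<close> and \<open>Z\<close> shows that these are all polynomials.
\<close>

inductive_set normal :: "'k poly poly poly set" where
  monomial: "[:[:p:]:] * basis n \<in> normal"
| multiple: "rel * H \<in> normal"
| add: "G \<in> normal \<Longrightarrow> G' \<in> normal \<Longrightarrow> G + G' \<in> normal"

lemma normal_0: "0 \<in> normal"
  using normal.multiple[of 0] by simp

lemma normal_sum: "(\<And>i. i \<in> I \<Longrightarrow> g i \<in> normal) \<Longrightarrow> sum g I \<in> normal"
  by (induction I rule: infinite_finite_induct) (auto simp: normal_0 intro: normal.add)

lemma normal_X: "G \<in> normal \<Longrightarrow> [:[:p:]:] * G \<in> normal"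
proof (induction rule: normal.induct)
  case (monomial q n)
  have "[:[:p:]:] * ([:[:q:]:] * basis n) = [:[:p * q:]:] * basis n" by simp
  then show ?case by (simp only: normal.monomial)
next
  case (multiple H)
  then show ?case using normal.multiple[of "[:[:p:]:] * H"] by (simp add: mult.left_commute)
next
  case (add G G')
  then show ?case by (simp only: distrib_left normal.add)
qed

lemma basis_add: "i < d \<Longrightarrow> basis (q * d + i) = [:0, 1:] ^ q * [:[:0, 1:]:] ^ i"
  using d by (simp add: basis_def)

lemma normal_Y: "G \<in> normal \<Longrightarrow> [:0, 1:] * G \<in> normal"
proof (induction rule: normal.induct)
  case (monomial q n)
  have "[:0, 1:] * ([:[:q:]:] * basis n) = [:[:q:]:] * ([:0, 1:] * basis n)"
    by (rule mult.left_commute)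
  also have "[:0, 1:] * basis n = basis (n + d)"
    using d by (simp only: basis_def div_add_self2 mod_add_self2 power_Suc mult.assoc)
       (simp add: basis_def mult.assoc)
  finally show ?case by (simp only: normal.monomial)
next
  case (multiple H)
  then show ?case using normal.multiple[of "[:0, 1:] * H"] by (simp only: mult.left_commute)
next
  case (add G G')
  then show ?case by (simp only: distrib_left normal.add)
qed

lemma Z_expansion:
  fixes q :: "'k poly poly"
  shows "[:q:] = (\<Sum>i\<le>degree q. [:[:coeff q i:]:] * [:[:0, 1:]:] ^ i)"
proof -
  have "type_hom (\<lambda>p :: 'k poly poly. [:p:])" by (simp add: type_hom_def one_pCons)
  note hom = type_hom_sum[OF this] type_homD[OF this] type_hom_power[OF this]
  have "q = (\<Sum>i\<le>degree q. [:coeff q i:] * [:0, 1:] ^ i)"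
    by (subst (1) poly_as_sum_of_monoms[symmetric]) (simp add: monom_altdef)
  then have "[:q:] = [:\<Sum>i\<le>degree q. [:coeff q i:] * [:0, 1:] ^ i:]" by simp
  then show ?thesis by (simp only: hom)
qed

text \<open>
  The polynomial \<open>\<phi>\<close> is monic in \<open>Z\<close>, so \<open>Z^d\<close> can be replaced by \<open>f Y\<close> minus the lower terms of \<open>\<phi>\<close>.
\<close>

lemma normal_Z_power: "[:[:0, 1:]:] ^ d * [:0, 1:] ^ q \<in> normal"
proof -
  let ?Z = "[:[:0, 1:]:] :: 'k poly poly poly" and ?Y = "[:0, 1:] :: 'k poly poly poly"
  have aux: "z = F + (- s) + (F - (s + z)) * (- 1)" for z F s :: "'k poly poly poly" by simp
  have "[:\<phi>:] = (\<Sum>i<d. [:[:coeff \<phi> i:]:] * ?Z ^ i) + ?Z ^ d"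
    by (subst Z_expansion, subst lessThan_Suc_atMost[symmetric], subst \<phi>(1), subst sum.lessThan_Suc)
       (use \<phi> in \<open>simp add: one_pCons[symmetric]\<close>)
  moreover have "(\<Sum>i<d. [:[:- coeff \<phi> i:]:] * ?Z ^ i) = - (\<Sum>i<d. [:[:coeff \<phi> i:]:] * ?Z ^ i)"
    by (subst sum_negf[symmetric], rule sum.cong) (simp_all flip: smult_minus_left)
  moreover have "rel = [:[:f:]:] * ?Y - [:\<phi>:]" by (rule rel_def)
  ultimately have "?Z ^ d = [:[:f:]:] * ?Y + (\<Sum>i<d. [:[:- coeff \<phi> i:]:] * ?Z ^ i) + rel * (-1)"
    by (simp only:) (rule aux)
  then have "?Z ^ d * ?Y ^ q = ([:[:f:]:] * ?Y + (\<Sum>i<d. [:[:- coeff \<phi> i:]:] * ?Z ^ i) + rel * (-1)) * ?Y ^ q"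
    by (rule arg_cong)
  also have "\<dots> = [:[:f:]:] * (?Y ^ Suc q)
      + (\<Sum>i<d. [:[:- coeff \<phi> i:]:] * (?Y ^ q * ?Z ^ i)) + rel * (- (?Y ^ q))"
    unfolding distrib_right sum_distrib_right power_Suc
    by (simp only: mult_ac mult_minus_left mult_minus_right mult_1_right mult_1_left)
  also have "\<dots> = [:[:f:]:] * basis (Suc q * d + 0)
      + (\<Sum>i<d. [:[:- coeff \<phi> i:]:] * basis (q * d + i)) + rel * (- (?Y ^ q))"
  proof -
    have "?Y ^ Suc q = basis (Suc q * d + 0)" using d by (subst basis_add) simp_all
    moreover have "(\<Sum>i<d. [:[:- coeff \<phi> i:]:] * (?Y ^ q * ?Z ^ i))
        = (\<Sum>i<d. [:[:- coeff \<phi> i:]:] * basis (q * d + i))"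
      by (rule sum.cong) (simp_all only: basis_add lessThan_iff)
    ultimately show ?thesis by (simp only:)
  qed
  also have "\<dots> \<in> normal"
    by (intro normal.add normal.monomial normal.multiple normal_sum)
  finally show ?thesis .
qed

lemma normal_Z: "G \<in> normal \<Longrightarrow> [:[:0, 1:]:] * G \<in> normal"
proof (induction rule: normal.induct)
  case (monomial p n)
  define q i where "q = n div d" and "i = n mod d"
  have n: "n = q * d + i" and i: "i < d" using d by (auto simp: q_def i_def)
  have "[:[:0, 1:]:] * basis n = [:[:0, 1:]:] ^ Suc i * [:0, 1:] ^ q"
    unfolding n basis_add[OF i] by (simp only: power_Suc mult_ac)
  also have "\<dots> \<in> normal"
  proof (cases "Suc i < d")
    case True
    have "[:[:0, 1:]:] ^ Suc i * [:0, 1:] ^ q = [:[:1:]:] * basis (q * d + Suc i)"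
      unfolding basis_add[OF True] by (simp add: mult.commute one_pCons[symmetric])
    then show ?thesis by (simp only: normal.monomial)
  next
    case False
    then have "Suc i = d" using i by simp
    then show ?thesis using normal_Z_power by (simp only:)
  qed
  finally show ?case
    using normal_X[of "[:[:0, 1:]:] * basis n" p] by (simp only: mult.left_commute)
next
  case (multiple H)
  then show ?case using normal.multiple[of "[:[:0, 1:]:] * H"] by (simp only: mult.left_commute)
next
  case (add G G')
  then show ?case by (simp only: distrib_left normal.add)
qed

lemma normal_UNIV: "G \<in> normal"
proof (induction G)
  case 0
  show ?case by (rule normal_0)
next
  case (pCons q G)
  have "[:q:] \<in> normal"
  proof (induction q)
    case 0
    show ?case using normal_0 by simp
  next
    case (pCons p q)
    have "[:pCons p q:] = [:[:p:]:] * basis 0 + [:[:0, 1:]:] * [:q:]"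
      by (simp add: basis_def)
    then show ?case using pCons by (simp only: normal.add normal.monomial normal_Z)
  qed
  moreover have "pCons q G = [:q:] + [:0, 1:] * G" by simp
  ultimately show ?case using pCons by (simp only: normal.add normal_Y)
qed

lemma const_add_mult: "[:[:a + b:]:] * G = [:[:a:]:] * G + [:[:b:]:] * (G :: 'k poly poly poly)"
proof -
  have "[:[:a + b:]:] = [:[:a:]:] + ([:[:b:]:] :: 'k poly poly poly)" by simp
  then show ?thesis by (simp only: distrib_right)
qed

lemma normal_form: "\<exists>N g H. G = (\<Sum>n<N. [:[:g n:]:] * basis n) + rel * H"
  using normal_UNIV[of G]
proof (induction rule: normal.induct)
  case (monomial p n)
  have "[:[:p:]:] * basis n
      = (\<Sum>m<Suc n. [:[:if m = n then p else 0:]:] * basis m) + rel * 0" by simp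
  then show ?case
    by (intro exI[of _ "Suc n"] exI[of _ "\<lambda>m. if m = n then p else 0"] exI[of _ 0])
next
  case (multiple H)
  have "rel * H = (\<Sum>m<0. [:[:0:]:] * basis m) + rel * H" by simp
  then show ?case by (intro exI[of _ 0] exI[of _ "\<lambda>_. 0"] exI[of _ H])
next
  case (add G G')
  obtain N g H where G: "G = (\<Sum>n<N. [:[:g n:]:] * basis n) + rel * H"
    using add.IH(1) by (elim exE) (rule that)
  obtain N' g' H' where G': "G' = (\<Sum>n<N'. [:[:g' n:]:] * basis n) + rel * H'"
    using add.IH(2) by (elim exE) (rule that)
  define M where "M = max N N'"
  have "(\<Sum>n<N. [:[:g n:]:] * basis n) = (\<Sum>n<M. [:[:if n < N then g n else 0:]:] * basis n)"
    by (rule sum.mono_neutral_cong_left) (auto simp: M_def)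
  moreover have "(\<Sum>n<N'. [:[:g' n:]:] * basis n) = (\<Sum>n<M. [:[:if n < N' then g' n else 0:]:] * basis n)"
    by (rule sum.mono_neutral_cong_left) (auto simp: M_def)
  ultimately have "G + G' = (\<Sum>n<M. [:[:(if n < N then g n else 0) + (if n < N' then g' n else 0):]:] * basis n)
      + rel * (H + H')"
    unfolding G G' const_add_mult sum.distrib distrib_left by (simp only: add_ac)
  then show ?case
    by (intro exI[of _ M] exI[of _ "\<lambda>n. (if n < N then g n else 0) + (if n < N' then g' n else 0)"]
        exI[of _ "H + H'"])
qed

definition bb :: "nat \<Rightarrow> 'k fls poly" where
  "bb n = yy ^ (n div d) * zz ^ (n mod d)"

lemma ev_basis: "ev (basis n) = bb n"
  by (simp only: basis_def bb_def type_homD[OF type_hom_ev] type_hom_power[OF type_hom_ev] ev_Y ev_Z)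

lemma ev_normal_form:
  "ev ((\<Sum>n<N. [:[:g n:]:] * basis n) + rel * H) = (\<Sum>n<N. smult (emb (g n)) (bb n))"
  by (simp only: type_hom_sum[OF type_hom_ev] type_homD[OF type_hom_ev] ev_X ev_basis ev_rel) simp

lemma bb_nonzero: "bb n \<noteq> 0"
  using yy_nonzero by (simp add: bb_def)

lemma degree_bb: "degree (bb n) = n"
  using yy_nonzero degree_yy by (simp add: bb_def degree_mult_eq degree_power_eq)

lemma degree_partial_sum: "N > 0 \<Longrightarrow> degree (\<Sum>n<N. smult (emb (g n)) (bb n)) < N"
proof -
  assume "N > 0"
  have "degree (\<Sum>n<N. smult (emb (g n)) (bb n)) \<le> N - 1"
    by (rule degree_sum_le) (auto simp: degree_bb)
  then show ?thesis using \<open>N > 0\<close> by simp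
qed

text \<open>
  Distinct basis elements have distinct degrees in \<open>Z\<close>, so nothing can cancel against the last term.
  This yields linear independence over \<open>K[X]\<close>, the kernel of \<open>ev\<close>, and all the weights of \<open>range ev\<close>.
\<close>

lemma top_of_partial_sum:
  assumes "g N \<noteq> 0"
  defines "a \<equiv> \<Sum>n<Suc N. smult (emb (g n)) (bb n)"
  shows "degree a = N" "lead_coeff a = lead_coeff (smult (emb (g N)) (bb N))"
proof -
  define b where "b = (\<Sum>n<N. smult (emb (g n)) (bb n))"
  have a: "a = b + smult (emb (g N)) (bb N)" by (simp add: a_def b_def)
  have dN: "degree (smult (emb (g N)) (bb N)) = N" using assms by (simp add: degree_bb)
  have cb: "coeff b i = 0" if "i \<ge> N" for i
  proof (cases "N = 0")
    case False
    then have "degree b < N" using degree_partial_sum unfolding b_def by blast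
    then show ?thesis using that by (simp add: coeff_eq_0)
  qed (simp add: b_def)
  have "coeff (smult (emb (g N)) (bb N)) N \<noteq> 0"
    using assms bb_nonzero dN by (metis emb_eq_0_iff leading_coeff_0_iff smult_eq_0_iff)
  then have "coeff a N \<noteq> 0" using cb[of N] by (simp add: a)
  moreover have "coeff a i = 0" if "i > N" for i
    using that cb[of i] dN by (simp add: a coeff_eq_0 degree_bb)
  ultimately show "degree a = N" by (metis degree_le le_degree le_antisym)
  then show "lead_coeff a = lead_coeff (smult (emb (g N)) (bb N))"
    using cb[of N] dN by (simp add: a)
qed

lemma partial_sum_eq_0:
  assumes "(\<Sum>n<N. smult (emb (g n)) (bb n)) = 0" "n < N"
  shows "g n = 0"
  using assms
proof (induction N)
  case (Suc N)
  have "g N = 0"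
  proof (rule ccontr)
    assume nz: "g N \<noteq> 0"
    have "lead_coeff (smult (emb (g N)) (bb N)) = 0"
      using top_of_partial_sum(2)[of g N, OF nz] unfolding Suc.prems(1) by simp
    then have "smult (emb (g N)) (bb N) = 0" by (simp only: leading_coeff_0_iff)
    then show False using nz bb_nonzero by simp
  qed
  then have "(\<Sum>n<N. smult (emb (g n)) (bb n)) = 0" using Suc.prems(1) by simp
  then show ?case using Suc.IH Suc.prems(2) \<open>g N = 0\<close> by (cases "n = N") simp_all
qed simp

text \<open>
  A polynomial in the kernel has a normal form whose coefficients vanish by linear independence.
\<close>

lemma kernel_ev: "ev G = 0 \<longleftrightarrow> (\<exists>H. G = rel * H)"
proof
  assume 0: "ev G = 0"
  obtain N g H where G: "G = (\<Sum>n<N. [:[:g n:]:] * basis n) + rel * H" using normal_form[of G] by (elim exE) (rule that)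
  from 0 have "(\<Sum>n<N. smult (emb (g n)) (bb n)) = 0" unfolding G ev_normal_form .
  then have "g n = 0" if "n < N" for n using partial_sum_eq_0 that by blast
  then have "G = rel * H" unfolding G by simp
  then show "\<exists>H. G = rel * H" ..
qed (auto simp: type_homD[OF type_hom_ev] ev_rel)

lemma expansion:
  assumes "a \<in> range ev" "a \<noteq> 0"
  shows "\<exists>N g. a = (\<Sum>n<Suc N. smult (emb (g n)) (bb n)) \<and> g N \<noteq> 0"
proof -
  obtain G where G: "a = ev G" using assms by blast
  obtain N g H where "G = (\<Sum>n<N. [:[:g n:]:] * basis n) + rel * H" using normal_form[of G] by (elim exE) (rule that)
  then have a: "a = (\<Sum>n<N. smult (emb (g n)) (bb n))" unfolding G by (simp only: ev_normal_form)
  from this assms(2) show ?thesis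
  proof (induction N)
    case (Suc N)
    show ?case
    proof (cases "g N = 0")
      case True
      then have "a = (\<Sum>n<N. smult (emb (g n)) (bb n))" using Suc.prems(1) by simp
      then show ?thesis using Suc.IH Suc.prems(2) by blast
    next
      case False
      then show ?thesis using Suc.prems(1) by blast
    qed
  qed simp
qed

lemma wt_xx: "wt xx = [:1, 0:]"
  by (simp add: wt_def)

lemma lc_xx: "lc xx = 1"
  by (simp add: lc_def)

lemma wt_zz: "wt zz = [:0, 1:]"
  by (simp add: wt_def)

lemma lc_zz: "lc zz = 1"
  by (simp add: lc_def)

lemma wt_emb: "wt [:emb p:] = [:of_nat (degree p), 0:]"
  by (simp add: wt_def subdegree_emb)

text \<open>
  The relation \<open>f Y = \<phi>\<close> has the leading part \<open>X^r Y = Z^d\<close>.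
\<close>

lemma wt_yy: "wt yy = [:- of_nat r, of_nat d:]"
proof -
  have "wt ([:emb f:] * yy) = wt (emb_Z \<phi>)" by (simp only: relation)
  also have "wt ([:emb f:] * yy) = wt [:emb f:] + wt yy"
    using f_nonzero yy_nonzero by (intro wt_mult) auto
  finally have "wt yy = wt (emb_Z \<phi>) - wt [:emb f:]" by simp
  then show ?thesis using f \<phi> by (simp add: wt_emb) (simp add: wt_def degree_emb_Z coeff_emb_Z)
qed

lemma lc_yy: "lc yy = 1"
proof -
  have "lc ([:emb f:] * yy) = lc (emb_Z \<phi>)" by (simp only: relation)
  also have "lc ([:emb f:] * yy) = lc [:emb f:] * lc yy"
    using f_nonzero yy_nonzero by (intro lc_mult) auto
  also have "lc [:emb f:] = 1" using f by (simp add: lc_def base_emb)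
  also have "lc (emb_Z \<phi>) = 1" using \<phi> by (simp add: lc_def degree_emb_Z coeff_emb_Z)
  finally show ?thesis by simp
qed

text \<open>
  The weights of the coordinate ring are those of the monomials in \<open>x\<close>, \<open>y\<close>, \<open>z\<close>; the leading
  monomial of \<open>g(x) b_n\<close> agrees with that of \<open>x^(degree g) b_n\<close>.
\<close>

lemma range_ev_wt:
  assumes "a \<in> range ev" "a \<noteq> 0"
  shows "\<exists>i. wt a = wt (xx ^ i * bb (degree a))"
proof -
  obtain N g where a: "a = (\<Sum>n<Suc N. smult (emb (g n)) (bb n))" and g: "g N \<noteq> 0"
    using expansion[OF assms] by (elim exE conjE) (rule that)
  note top = top_of_partial_sum[of g N, OF g, folded a]
  have "degree (smult (emb (g N)) (bb N)) = N" using g by (simp add: degree_bb)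
  then have "wt a = wt ([:emb (g N):] * bb N)" using top by (simp add: wt_def)
  also have "\<dots> = wt [:emb (g N):] + wt (bb N)" using g bb_nonzero by (intro wt_mult) auto
  also have "wt [:emb (g N):] = wt (xx ^ degree (g N))"
    by (subst wt_power) (auto simp: wt_xx wt_emb of_nat_poly)
  also have "\<dots> + wt (bb N) = wt (xx ^ degree (g N) * bb N)"
    using bb_nonzero by (subst wt_mult) auto
  finally show ?thesis using top(1) by blast
qed

lemma range_ev_degree_0:
  assumes "a \<in> range ev" "degree a = 0"
  shows "\<exists>p. a = [:emb p:]"
proof (cases "a = 0")
  case True
  then show ?thesis by (intro exI[of _ 0]) simp
next
  case False
  obtain N g where a: "a = (\<Sum>n<Suc N. smult (emb (g n)) (bb n))" and g: "g N \<noteq> 0"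
    using expansion[OF assms(1) False] by (elim exE conjE) (rule that)
  then have "N = 0" using top_of_partial_sum(1)[of g N, OF g] assms(2) by simp
  then show ?thesis using a by (intro exI[of _ "g 0"]) (simp add: bb_def)
qed

end

section \<open>Classification of the iterative derivations of the surface\<close>

context surface
begin

lemma range_add: "a \<in> range ev \<Longrightarrow> b \<in> range ev \<Longrightarrow> a + b \<in> range ev"
  using type_homD(3)[OF type_hom_ev] by (auto simp: image_iff) metis

lemma range_mult: "a \<in> range ev \<Longrightarrow> b \<in> range ev \<Longrightarrow> a * b \<in> range ev"
  using type_homD(4)[OF type_hom_ev] by (auto simp: image_iff) metis

lemma emb_in_range: "[:emb p:] \<in> range ev"
  using ev_X by (metis rangeI)

lemma emb_X: "emb [:0, 1:] = fls_X_inv"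
  by (simp add: emb_pCons)

lemma emb_const: "emb [:c:] = fls_const c"
  by (simp add: emb_pCons)

lemma scal_in_range: "scal c \<in> range ev"
  using emb_in_range[of "[:c:]"] by (simp add: emb_const)

lemma xx_in_range: "xx \<in> range ev"
  using emb_in_range[of "[:0, 1:]"] by (simp only: emb_X)

lemma yy_in_range: "yy \<in> range ev"
  using ev_Y by (metis rangeI)

lemma zz_in_range: "zz \<in> range ev"
  using ev_Z by (metis rangeI)

lemma emb_Z_in_range: "emb_Z q \<in> range ev"
  using ev_const by (metis rangeI)

lemma bb_in_range: "bb n \<in> range ev"
  using ev_basis by (metis rangeI)

lemma emb_poly_induct:
  assumes "\<And>c. P (scal c)" "\<And>c p. P [:emb p:] \<Longrightarrow> P (scal c + xx * [:emb p:])"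
  shows "P [:emb p:]"
proof (induction p)
  case 0
  show ?case using assms(1)[of 0] by simp
next
  case (pCons c p)
  have "[:emb (pCons c p):] = scal c + xx * [:emb p:]" by (simp add: emb_pCons)
  then show ?case using assms(2)[OF pCons(2)] by simp
qed

lemma range_ev_induct [consumes 1, case_names scal x y z add mult]:
  assumes "a \<in> range ev"
    and scal: "\<And>c. P (scal c)" and x: "P xx" and y: "P yy" and z: "P zz"
    and add: "\<And>a b. a \<in> range ev \<Longrightarrow> b \<in> range ev \<Longrightarrow> P a \<Longrightarrow> P b \<Longrightarrow> P (a + b)"
    and mult: "\<And>a b. a \<in> range ev \<Longrightarrow> b \<in> range ev \<Longrightarrow> P a \<Longrightarrow> P b \<Longrightarrow> P (a * b)"
  shows "P a"
proof -
  have X: "P [:emb p:]" for p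
    by (induction rule: emb_poly_induct)
       (intro scal add mult x scal_in_range xx_in_range emb_in_range range_mult | assumption)+
  have Z: "P (emb_Z q)" for q
  proof (induction q)
    case 0
    show ?case using scal[of 0] by simp
  next
    case (pCons p q)
    have "emb_Z (pCons p q) = [:emb p:] + zz * emb_Z q" by simp
    then show ?case
      using add[OF emb_in_range range_mult[OF zz_in_range emb_Z_in_range] X
          mult[OF zz_in_range emb_Z_in_range z pCons(2)]] by (simp only:)
  qed
  have "P (ev G)" for G
  proof (induction G)
    case 0
    show ?case using scal[of 0] by (simp add: ev_def)
  next
    case (pCons q G)
    have "ev (pCons q G) = emb_Z q + yy * ev G"
      by (simp add: ev_def eval_hom_pCons[OF type_hom_emb_Z])
    then show ?case
      using add[OF emb_Z_in_range range_mult[OF yy_in_range rangeI] Z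
          mult[OF yy_in_range rangeI y pCons(2)]] by (simp only:)
  qed
  then show ?thesis using assms(1) by blast
qed

lemma monomial_wt: "wt (xx ^ i * bb n) = [:of_nat i - of_nat r * of_nat (n div d), of_nat n:]"
proof -
  have "wt (xx ^ i * bb n) = of_nat i * wt xx + (of_nat (n div d) * wt yy + of_nat (n mod d) * wt zz)"
    using yy_nonzero bb_nonzero[of n] unfolding bb_def by (simp add: wt_mult wt_power)
  also have "\<dots> = [:of_nat i - of_nat r * of_nat (n div d),
      of_nat (n div d) * of_nat d + of_nat (n mod d):]"
    by (simp add: wt_xx wt_yy wt_zz of_nat_poly)
  also have "of_nat (n div d) * of_nat d + of_nat (n mod d) = (of_nat n :: rat)"
    by (metis div_mult_mod_eq of_nat_add of_nat_mult)
  finally show ?thesis .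
qed

end

subsection \<open>The steepest slope\<close>

locale surface_derivation = surface r d f \<phi> + higher_derivation "range ev" D
  for r d :: nat and f :: "'k::field poly" and \<phi> and D
begin

lemma constant_of_generators:
  assumes "a \<in> range ev" "\<forall>n>0. D n xx = 0" "\<forall>n>0. D n yy = 0" "\<forall>n>0. D n zz = 0"
  shows "\<forall>n>0. D n a = 0"
  using assms(1)
proof (induction rule: range_ev_induct)
  case (scal c)
  show ?case by (simp add: D_scal)
next
  case (add a b)
  then show ?case by (rule constant_add)
next
  case (mult a b)
  then show ?case by (rule constant_mult)
qed (rule assms)+

text \<open>
  The weight \<open>\<gamma>\<close> replaces \<open>wt a\<close> because the weight of a sum may drop, while a common bound \<open>\<gamma>\<close> of the
  summands persists.
\<close>

definition slope_le :: "rat poly \<Rightarrow> 'k fls poly \<Rightarrow> rat poly \<Rightarrow> bool" where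
  "slope_le u a \<gamma> \<longleftrightarrow> (\<forall>i. wt_le (D i a) (\<gamma> + of_nat i * u))"

lemma slope_le_mult:
  assumes "a \<in> range ev" "b \<in> range ev" "slope_le u a \<gamma>" "slope_le u b \<delta>"
  shows "slope_le u (a * b) (\<gamma> + \<delta>)"
  unfolding slope_le_def
proof
  fix n
  have "wt_le (D i a * D (n - i) b) (\<gamma> + \<delta> + of_nat n * u)" if "i \<le> n" for i
  proof -
    have "\<gamma> + \<delta> + of_nat n * u = (\<gamma> + of_nat i * u) + (\<delta> + of_nat (n - i) * u)"
      using that by (simp add: of_nat_diff algebra_simps)
    then show ?thesis using assms(3,4) by (simp only: slope_le_def wt_le_mult)
  qed
  then show "wt_le (D n (a * b)) (\<gamma> + \<delta> + of_nat n * u)"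
    unfolding D_mult[OF assms(1,2)] by (intro wt_le_sum) simp
qed

lemma slope_le_add:
  assumes "a \<in> range ev" "b \<in> range ev" "slope_le u a \<gamma>" "slope_le u b \<gamma>"
  shows "slope_le u (a + b) \<gamma>"
  using assms by (simp add: slope_le_def D_add wt_le_add)

lemma slope_le_mono: "slope_le u a \<gamma> \<Longrightarrow> \<gamma> \<le> \<delta> \<Longrightarrow> slope_le u a \<delta>"
  unfolding slope_le_def by (meson add_right_mono wt_le_trans)

lemma slope_le_scal: "slope_le u (scal c) 0"
  unfolding slope_le_def
proof
  fix i
  show "wt_le (D i (scal c)) (0 + of_nat i * u)"
    by (cases "i = 0") (simp_all add: D_zero scal_mem D_scal wt_le_def)
qed

lemma slope_le_power:
  assumes "a \<in> range ev" "slope_le u a \<gamma>"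
  shows "slope_le u (a ^ n) (of_nat n * \<gamma>)"
proof (induction n)
  case 0
  show ?case using slope_le_scal[of u 1] by (simp add: one_pCons)
next
  case (Suc n)
  have "of_nat (Suc n) * \<gamma> = \<gamma> + of_nat n * \<gamma>" by (simp add: algebra_simps)
  then show ?case using slope_le_mult[OF assms(1) power_mem[OF assms(1)] assms(2) Suc]
    by (simp only: power_Suc)
qed

text \<open>
  Every element is a sum of multiples of basis elements by polynomials in \<open>x\<close>, none of which
  exceeds the weight of the sum. Products keep the slope by the Leibniz rule, so the bound passes
  from the generators to all elements.
\<close>

lemma slope_of_generators:
  assumes x: "slope_le u xx (wt xx)" and y: "slope_le u yy (wt yy)" and z: "slope_le u zz (wt zz)"
    and a: "a \<in> range ev" "a \<noteq> 0"
  shows "slope_le u a (wt a)"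
proof -
  have X: "slope_le u [:emb p:] (wt [:emb p:])" for p
  proof (induction p)
    case 0
    show ?case using slope_le_scal[of u 0] by (simp add: wt_def)
  next
    case (pCons c p)
    show ?case
    proof (cases "p = 0")
      case True
      then show ?thesis using slope_le_scal[of u c] by (simp add: emb_pCons)
    next
      case False
      have eq: "[:emb (pCons c p):] = scal c + xx * [:emb p:]" by (simp add: emb_pCons)
      have w: "wt [:emb (pCons c p):] = wt xx + wt [:emb p:]"
        using False by (simp add: wt_emb wt_xx)
      have "(0::rat poly) = [:0, 0:]" by simp
      also have "[:0, 0:] \<le> wt [:emb (pCons c p):]"
        unfolding wt_emb by (subst lex_le_iff) simp
      finally have "slope_le u (scal c) (wt [:emb (pCons c p):])"
        using slope_le_mono slope_le_scal by blast
      moreover have "slope_le u (xx * [:emb p:]) (wt [:emb (pCons c p):])"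
        unfolding w by (intro slope_le_mult xx_in_range emb_in_range x pCons)
      ultimately show ?thesis
        unfolding eq by (intro slope_le_add scal_in_range range_mult xx_in_range emb_in_range)
    qed
  qed
  have B: "slope_le u (bb n) (wt (bb n))" for n
  proof -
    have "wt (bb n) = of_nat (n div d) * wt yy + of_nat (n mod d) * wt zz"
      using yy_nonzero by (simp add: bb_def wt_mult wt_power)
    then show ?thesis
      unfolding bb_def by (simp only:) (intro slope_le_mult slope_le_power power_mem yy_in_range zz_in_range y z)
  qed
  have sum: "slope_le u (\<Sum>n<N. smult (emb (g n)) (bb n)) (wt (\<Sum>n<N. smult (emb (g n)) (bb n)))" for N g
  proof (induction N)
    case 0
    have "D i 0 = 0" for i by (rule D_at_0)
    then show ?case by (simp add: slope_le_def)
  next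
    case (Suc N)
    define b where "b = (\<Sum>n<N. smult (emb (g n)) (bb n))"
    define a where "a = (\<Sum>n<Suc N. smult (emb (g n)) (bb n))"
    have ab: "a = b + [:emb (g N):] * bb N" by (simp add: a_def b_def)
    show ?case
    proof (cases "g N = 0")
      case True
      then show ?thesis using Suc by simp
    next
      case False
      note top = top_of_partial_sum[of g N, OF False, folded a_def]
      have "degree (smult (emb (g N)) (bb N)) = N" using False by (simp add: degree_bb)
      then have "wt a = wt ([:emb (g N):] * bb N)" using top by (simp add: wt_def)
      also have "\<dots> = wt [:emb (g N):] + wt (bb N)" using False bb_nonzero by (intro wt_mult) auto
      finally have wa: "wt a = wt [:emb (g N):] + wt (bb N)" .
      have mem: "b \<in> range ev"
      proof -
        have "b = ev ((\<Sum>n<N. [:[:g n:]:] * basis n) + rel * 0)"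
          unfolding b_def ev_normal_form ..
        then show ?thesis by blast
      qed
      have "slope_le u b (wt a)"
      proof (cases "b = 0")
        case True
        then show ?thesis by (simp add: slope_le_def D_at_0)
      next
        case False
        then have "N > 0" by (auto simp: b_def intro: gr0I)
        then have "degree b < N" using degree_partial_sum by (simp add: b_def)
        then have "wt b \<le> wt a" using top(1) by (simp add: wt_def lex_le_iff)
        then show ?thesis using Suc slope_le_mono unfolding b_def by blast
      qed
      moreover have "slope_le u ([:emb (g N):] * bb N) (wt a)"
        unfolding wa by (intro slope_le_mult emb_in_range bb_in_range X B)
      ultimately have "slope_le u a (wt a)"
        unfolding ab by (intro slope_le_add mem range_mult emb_in_range bb_in_range)
      then show ?thesis by (simp only: a_def)
    qed
  qed
  obtain N g where "a = (\<Sum>n<Suc N. smult (emb (g n)) (bb n))"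
    using expansion[OF a] by (elim exE conjE) (rule that)
  then show ?thesis using sum[of g "Suc N"] by (simp only:)
qed

text \<open>
  The generators have finitely many nonzero derivatives, and \<open>u\<close> is the largest of the slopes
  \<open>(wt (D i g) - wt g) / i\<close>.
\<close>

lemma exists_slope:
  assumes "\<not> (\<forall>a\<in>range ev. \<forall>n>0. D n a = 0)"
  shows "\<exists>u. slope_le u xx (wt xx) \<and> slope_le u yy (wt yy) \<and> slope_le u zz (wt zz) \<and>
    (\<exists>g\<in>{xx, yy, zz}. \<exists>i>0. D i g \<noteq> 0 \<and> wt (D i g) = wt g + of_nat i * u)"
proof -
  have gens: "{xx, yy, zz} \<subseteq> range ev"
    by (simp only: insert_subset empty_subsetI xx_in_range yy_in_range zz_in_range simp_thms)
  have "\<exists>N. \<forall>n>N. \<forall>g\<in>{xx, yy, zz}. D n g = 0"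
  proof -
    obtain N1 where "\<forall>n>N1. D n xx = 0" using D_finite[OF xx_in_range] by (rule exE)
    moreover obtain N2 where "\<forall>n>N2. D n yy = 0" using D_finite[OF yy_in_range] by (rule exE)
    moreover obtain N3 where "\<forall>n>N3. D n zz = 0" using D_finite[OF zz_in_range] by (rule exE)
    ultimately show ?thesis by (intro exI[of _ "max N1 (max N2 N3)"]) auto
  qed
  then obtain N where N: "\<forall>n>N. \<forall>g\<in>{xx, yy, zz}. D n g = 0" by blast
  define S where "S = {(g, i). g \<in> {xx, yy, zz} \<and> i \<in> {1..N} \<and> D i g \<noteq> 0}"
  define s where "s = (\<lambda>(g, i). smult (1 / of_nat i) (wt (D i g) - wt g))"
  define u where "u = Max (s ` S)"
  have "finite S"
    by (rule finite_subset[of _ "{xx, yy, zz} \<times> {1..N}"]) (auto simp: S_def)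
  have inS: "(g, i) \<in> S" if "g \<in> {xx, yy, zz}" "i > 0" "D i g \<noteq> 0" for g i
    using that N unfolding S_def by (auto simp: not_less[symmetric])
  have "S \<noteq> {}"
  proof
    assume "S = {}"
    then have "D i g = 0" if "g \<in> {xx, yy, zz}" "i > 0" for g i using inS that by blast
    then show False using assms constant_of_generators by blast
  qed
  have scale: "of_nat i * s (g, i) = wt (D i g) - wt g" if "i > 0" for g i
    using that by (simp add: s_def of_nat_poly)
  have le: "slope_le u g (wt g)" if g: "g \<in> {xx, yy, zz}" for g
    unfolding slope_le_def
  proof
    fix i
    show "wt_le (D i g) (wt g + of_nat i * u)"
    proof (cases "i = 0 \<or> D i g = 0")
      case True
      then show ?thesis using g gens D_zero[of g] by (auto simp: wt_le_refl)
    next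
      case False
      then have "(g, i) \<in> S" using inS g by blast
      then have "s (g, i) \<le> u" using \<open>finite S\<close> by (simp add: u_def)
      then have "of_nat i * s (g, i) \<le> of_nat i * u" by (intro mult_left_mono) auto
      then have "wt (D i g) - wt g \<le> of_nat i * u" using scale[of i g] False by simp
      then show ?thesis by (simp add: wt_le_def diff_le_eq add.commute)
    qed
  qed
  have "u \<in> s ` S" unfolding u_def using \<open>finite S\<close> \<open>S \<noteq> {}\<close> by (intro Max_in) auto
  then obtain g i where gi: "(g, i) \<in> S" "u = s (g, i)" by auto
  then have "i > 0" "g \<in> {xx, yy, zz}" "D i g \<noteq> 0" by (auto simp: S_def)
  moreover have "wt (D i g) = wt g + of_nat i * u" using scale[OF \<open>i > 0\<close>, of g] gi by simp
  ultimately show ?thesis using le by blast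
qed

end

subsection \<open>The direction of the slope\<close>

locale sloped_surface = surface_derivation r d f \<phi> D + sloped_derivation "range ev" D u
  for r d :: nat and f :: "'k::field poly" and \<phi> D u +
  assumes attained: "ideg xx > 0 \<or> ideg yy > 0 \<or> ideg zz > 0"
begin

lemma relation_wt: "wt (xx ^ r * yy) = wt (zz ^ d)"
  using yy_nonzero by (simp add: wt_mult wt_power wt_xx wt_yy wt_zz of_nat_poly)

lemma relation_ideg: "r * ideg xx + ideg yy = d * ideg zz"
proof -
  have "ideg (xx ^ r * yy) = ideg (zz ^ d)"
    using yy_nonzero
    by (intro ideg_eq_of_wt_eq relation_wt range_mult power_mem xx_in_range yy_in_range zz_in_range) auto
  then show ?thesis
    using yy_nonzero
    by (simp add: ideg_mult ideg_power power_mem xx_in_range yy_in_range zz_in_range)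
qed

lemma ideg_zz_pos: "ideg zz > 0"
proof (rule ccontr)
  assume "\<not> ideg zz > 0"
  then have "r * ideg xx + ideg yy = 0" "ideg zz = 0" using relation_ideg by simp_all
  then show False using attained r by simp
qed

lemma range_form:
  assumes "a \<in> range ev" "a \<noteq> 0"
  obtains i j k where
    "coeff (wt a) 0 = of_nat i - of_nat r * of_nat j" "coeff (wt a) 1 = of_nat d * of_nat j + of_nat k"
    "ideg a = i * ideg xx + j * ideg yy + k * ideg zz" "degree a = d * j + k"
proof -
  obtain i where w: "wt a = wt (xx ^ i * bb (degree a))" using range_ev_wt[OF assms] by blast
  define j k where "j = degree a div d" and "k = degree a mod d"
  have jk: "degree a = d * j + k" by (simp add: j_def k_def)
  have "ideg a = ideg (xx ^ i * bb (degree a))"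
    using assms w bb_nonzero bb_in_range
    by (intro ideg_eq_of_wt_eq range_mult power_mem xx_in_range) auto
  also have "\<dots> = ideg (xx ^ i * (yy ^ j * zz ^ k))"
    by (simp only: bb_def j_def k_def)
  also have "\<dots> = i * ideg xx + j * ideg yy + k * ideg zz"
    using yy_nonzero
    by (simp add: ideg_mult ideg_power power_mem range_mult xx_in_range yy_in_range zz_in_range)
  finally have "ideg a = i * ideg xx + j * ideg yy + k * ideg zz" .
  moreover have "coeff (wt a) 0 = of_nat i - of_nat r * of_nat j"
    unfolding w monomial_wt by (simp add: j_def)
  moreover have "coeff (wt a) 1 = of_nat d * of_nat j + of_nat k"
  proof -
    have "coeff (wt a) 1 = of_nat (degree a)" unfolding w monomial_wt by simp
    also have "\<dots> = of_nat (d * j + k)" by (rule arg_cong[OF jk])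
    finally show ?thesis by simp
  qed
  ultimately show ?thesis using jk by (intro that)
qed

text \<open>
  By \<open>leading_derivative\<close>, \<open>wt zz + ideg zz * u\<close> is the weight of a monomial \<open>x^i y^j z^k\<close> of \<open>ideg\<close> zero.
\<close>

lemma zz_direction:
  obtains i j k where
    "of_nat (ideg zz) * coeff u 0 = of_nat i - of_nat r * of_nat j"
    "1 + of_nat (ideg zz) * coeff u 1 = of_nat d * of_nat j + of_nat k"
    "i * ideg xx + j * ideg yy + k * ideg zz = 0"
proof -
  have "zz \<noteq> 0" by simp
  note b = leading_derivative[OF zz_in_range this]
  obtain i j k where ijk:
    "coeff (wt (D (ideg zz) zz)) 0 = of_nat i - of_nat r * of_nat j"
    "coeff (wt (D (ideg zz) zz)) 1 = of_nat d * of_nat j + of_nat k"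
    "ideg (D (ideg zz) zz) = i * ideg xx + j * ideg yy + k * ideg zz"
    using range_form[OF b(1,2)] by metis
  show ?thesis
    using that[of i j k] ijk b(3,4) by (simp add: wt_zz of_nat_poly)
qed

lemma xx_direction:
  obtains i j k where
    "1 + of_nat (ideg xx) * coeff u 0 = of_nat i - of_nat r * of_nat j"
    "of_nat (ideg xx) * coeff u 1 = of_nat d * of_nat j + of_nat k"
    "i * ideg xx + j * ideg yy + k * ideg zz = 0"
proof -
  have "xx \<noteq> 0" by simp
  note b = leading_derivative[OF xx_in_range this]
  obtain i j k where ijk:
    "coeff (wt (D (ideg xx) xx)) 0 = of_nat i - of_nat r * of_nat j"
    "coeff (wt (D (ideg xx) xx)) 1 = of_nat d * of_nat j + of_nat k"
    "ideg (D (ideg xx) xx) = i * ideg xx + j * ideg yy + k * ideg zz"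
    using range_form[OF b(1,2)] by metis
  show ?thesis
    using that[of i j k] ijk b(3,4) by (simp add: wt_xx of_nat_poly)
qed

text \<open>
  The functional \<open>[:\<alpha>, \<beta>:] \<mapsto> d \<alpha> + r \<beta>\<close> takes the values \<open>d\<close>, \<open>r\<close> and 0 on \<open>wt xx\<close>, \<open>wt zz\<close> and
  \<open>wt yy\<close>, and \<open>slope\<close> says that it is \<open>-1/e\<close> on \<open>u\<close>. If \<open>i\<close> is an exponent of \<open>initial g\<close>, its value
  \<open>n - i/e\<close> on \<open>wt (D i g)\<close> thus lies in the semigroup generated by \<open>d\<close> and \<open>r\<close>. Both generators are at
  least 2, so a nonzero value is at least 2.
\<close>

lemma gap_of_cusp:
  assumes slope: "of_nat d * coeff u 0 + of_nat r * coeff u 1 = - 1 / of_nat e"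
    and e: "e > 0" and g: "g \<in> range ev" "coeff (initial g) i \<noteq> 0"
    and n: "of_nat d * coeff (wt g) 0 + of_nat r * coeff (wt g) 1 = (of_nat n :: rat)"
    and i: "i < n * e"
  shows "i + 2 * e \<le> n * e"
proof -
  note w = wt_of_coeff_initial[OF g]
  obtain i' j k where ijk:
    "coeff (wt (D i g)) 0 = of_nat i' - of_nat r * of_nat j"
    "coeff (wt (D i g)) 1 = of_nat d * of_nat j + of_nat k"
    using range_form[OF D_mem[OF g(1)] w(1)] by metis
  have w0: "coeff (wt (D i g)) 0 = coeff (wt g) 0 + of_nat i * coeff u 0"
    and w1: "coeff (wt (D i g)) 1 = coeff (wt g) 1 + of_nat i * coeff u 1"
    unfolding w(2) by (simp_all add: of_nat_poly)
  have "of_nat d * coeff (wt (D i g)) 0 + of_nat r * coeff (wt (D i g)) 1 = (of_nat (d * i' + r * k) :: rat)"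
    unfolding ijk by (simp add: algebra_simps)
  moreover have "of_nat d * coeff (wt (D i g)) 0 + of_nat r * coeff (wt (D i g)) 1
      = of_nat n + of_nat i * (of_nat d * coeff u 0 + of_nat r * coeff u 1)"
    unfolding w0 w1 n[symmetric] by (simp add: algebra_simps)
  ultimately have "(of_nat (d * i' + r * k) :: rat) = of_nat n - of_nat i / of_nat e"
    unfolding slope by simp
  then have "(of_nat ((d * i' + r * k) * e + i) :: rat) = of_nat (n * e)"
    using e by (simp add: field_simps)
  then have eq: "(d * i' + r * k) * e + i = n * e" by (simp only: of_nat_eq_iff)
  have "d * i' + r * k \<noteq> 0" using eq i by (intro notI) simp
  then have "i' > 0 \<or> k > 0" by (cases i'; cases k) auto
  then have "2 \<le> d * i' + r * k"
  proof
    assume "i' > 0"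
    then have "2 * 1 \<le> d * i'" using d by (intro mult_le_mono) auto
    then show ?thesis by simp
  next
    assume "k > 0"
    then have "2 * 1 \<le> r * k" using r by (intro mult_le_mono) auto
    then show ?thesis by simp
  qed
  then have "2 * e \<le> (d * i' + r * k) * e" by (rule mult_le_mono1)
  then show ?thesis unfolding eq[symmetric] by linarith
qed

text \<open>
  Suppose \<open>ideg xx > 0\<close>. Then a monomial of \<open>ideg\<close> zero is a power of \<open>y\<close>, since \<open>ideg zz > 0\<close>.

  If \<open>ideg yy > 0\<close> too, it is \<open>1\<close>, and both \<open>wt xx\<close> and \<open>wt zz\<close> are multiples of \<open>u\<close>, although
  they are linearly independent.

  If \<open>ideg yy = 0\<close>, the homogeneous part fixes \<open>Y\<close> and lives on the curve \<open>X^r Y = Z^d\<close> over \<open>K(Y)\<close>.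
  The two equations for \<open>u\<close> force \<open>r\<close> and \<open>d\<close> to be coprime, and \<open>no_gapped_cusp\<close> applies: a cuspidal
  curve carries no nontrivial exponential map.
\<close>

lemma ideg_xx_0: "ideg xx = 0"
proof (rule ccontr)
  assume "ideg xx \<noteq> 0"
  define \<alpha> \<beta> where "\<alpha> = ideg xx" and "\<beta> = ideg zz"
  have pos: "\<alpha> > 0" "\<beta> > 0" using \<open>ideg xx \<noteq> 0\<close> ideg_zz_pos by (simp_all add: \<alpha>_def \<beta>_def)
  obtain i1 j1 k1 where 1:
    "1 + of_nat \<alpha> * coeff u 0 = of_nat i1 - of_nat r * of_nat j1"
    "of_nat \<alpha> * coeff u 1 = of_nat d * of_nat j1 + of_nat k1"
    "i1 * \<alpha> + j1 * ideg yy + k1 * \<beta> = 0"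
    using xx_direction unfolding \<alpha>_def \<beta>_def by metis
  obtain i2 j2 k2 where 2:
    "of_nat \<beta> * coeff u 0 = of_nat i2 - of_nat r * of_nat j2"
    "1 + of_nat \<beta> * coeff u 1 = of_nat d * of_nat j2 + of_nat k2"
    "i2 * \<alpha> + j2 * ideg yy + k2 * \<beta> = 0"
    using zz_direction unfolding \<alpha>_def \<beta>_def by metis
  have ik: "i1 = 0" "k1 = 0" "i2 = 0" "k2 = 0" using 1(3) 2(3) pos by simp_all
  show False
  proof (cases "ideg yy = 0")
    case False
    then have "j1 = 0" "j2 = 0" using 1(3) 2(3) by simp_all
    then have "coeff u 0 = 0" using 2(1) ik pos by simp
    then show False using 1(1) ik \<open>j1 = 0\<close> by simp
  next
    case True
    then have rel: "r * \<alpha> = d * \<beta>" using relation_ideg by (simp add: \<alpha>_def \<beta>_def)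
    \<comment> \<open>Eliminating \<open>u\<close> from the first coordinates shows that \<open>r\<close> divides \<open>ideg zz\<close>, with quotient \<open>c\<close>.
      By the fact \<open>rel\<close>, the same \<open>c\<close> is the quotient of \<open>ideg xx\<close> by \<open>d\<close>; substituting both into the
      definition of \<open>c\<close> gives a Bezout identity for \<open>r\<close> and \<open>d\<close>.\<close>
    define c where "c = int j2 * int \<alpha> - int j1 * int \<beta>"
    have "(of_nat \<beta> :: rat) * (1 + of_nat \<alpha> * coeff u 0) = of_nat \<beta> + of_nat \<alpha> * (of_nat \<beta> * coeff u 0)"
      by (simp add: algebra_simps)
    then have "(of_nat \<beta> :: rat) = of_nat r * (of_nat j2 * of_nat \<alpha> - of_nat j1 * of_nat \<beta>)"
      unfolding 1(1) 2(1) using ik by (simp add: algebra_simps)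
    also have "\<dots> = of_int (int r * c)" by (simp add: c_def)
    finally have \<beta>: "int \<beta> = int r * c" by (metis of_int_eq_iff of_int_of_nat_eq)
    then have "c > 0" using pos r by (metis of_nat_0_less_iff zero_less_mult_pos less_le_trans pos2)
    define e where "e = nat c"
    have e: "e > 0" "\<beta> = r * e" using \<open>c > 0\<close> \<beta> by (auto simp: e_def) (metis int_eq_iff nat_int nat_mult_distrib of_nat_0_le_iff)
    have "r * \<alpha> = r * (d * e)" unfolding rel e(2) by (rule mult.left_commute)
    then have \<alpha>: "\<alpha> = d * e" using r by (simp only: mult_cancel_left) simp
    have "int e = c" using \<open>c > 0\<close> by (simp add: e_def)
    then have "int e * 1 = int e * (int j2 * int d - int j1 * int r)"
      unfolding c_def \<alpha> e(2) by (simp add: algebra_simps)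
    then have bez: "int j2 * int d - int j1 * int r = 1" using e(1) by simp
    have cop: "coprime r d"
    proof (rule coprimeI)
      fix m assume "m dvd r" "m dvd d"
      then have "int m dvd int j2 * int d - int j1 * int r" by simp
      then show "is_unit m" unfolding bez by simp
    qed
    have slope: "of_nat d * coeff u 0 + of_nat r * coeff u 1 = - 1 / of_nat e"
    proof -
      have "of_nat \<alpha> * (of_nat d * coeff u 0 + of_nat r * coeff u 1)
          = of_nat d * (of_nat \<alpha> * coeff u 0) + of_nat r * (of_nat \<alpha> * coeff u 1)"
        by (simp add: algebra_simps)
      also have "of_nat \<alpha> * coeff u 0 = - 1 - of_nat r * of_nat j1" using 1(1) ik by (simp add: algebra_simps)
      also have "of_nat \<alpha> * coeff u 1 = of_nat d * of_nat j1" using 1(2) ik by simp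
      finally have "of_nat \<alpha> * (of_nat d * coeff u 0 + of_nat r * coeff u 1) = - of_nat d"
        by (simp add: algebra_simps)
      then have "of_nat d * (of_nat e * (of_nat d * coeff u 0 + of_nat r * coeff u 1)) = of_nat d * (- 1)"
        unfolding \<alpha> of_nat_mult by (simp only: mult.assoc mult_minus1_right)
      then have "of_nat e * (of_nat d * coeff u 0 + of_nat r * coeff u 1) = - 1"
        unfolding mult_cancel_left using d by simp
      then show ?thesis using e(1) by (subst eq_divide_eq) (simp add: mult.commute)
    qed
    have nz: "xx \<noteq> 0" "zz \<noteq> 0" "yy \<noteq> 0" using yy_nonzero by auto
    have deg: "degree (initial xx) = d * e" "degree (initial zz) = r * e"
      using \<alpha> e(2) by (simp_all add: \<alpha>_def \<beta>_def ideg_def)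
    have "degree (initial yy) = 0" using True by (simp add: ideg_def)
    then obtain y0 where "initial yy = [:y0:]" by (rule degree_eq_zeroE)
    moreover have "coeff (initial yy) 0 = 1"
      using coeff_0_initial[OF yy_in_range nz(3)] lc_yy by simp
    ultimately have iy: "initial yy = 1" by (simp add: one_pCons)
    have "smult (lc (zz ^ d)) (initial (xx ^ r * yy)) = smult (lc (xx ^ r * yy)) (initial (zz ^ d))"
      using nz by (intro initial_eq_of_wt_eq relation_wt range_mult power_mem xx_in_range yy_in_range zz_in_range) auto
    moreover have "lc (zz ^ d) = 1" using lc_power[OF nz(2), of d] lc_zz by simp
    moreover have "lc (xx ^ r * yy) = 1"
      using lc_power[OF nz(1), of r] lc_xx lc_yy lc_mult[of "xx ^ r" yy] nz by simp
    ultimately have "initial (xx ^ r * yy) = initial (zz ^ d)" by simp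
    then have pq: "initial xx ^ r = initial zz ^ d"
      using initial_mult[OF power_mem[OF xx_in_range] yy_in_range _ nz(3), of r]
        initial_power[OF xx_in_range nz(1)] initial_power[OF zz_in_range nz(2)] iy nz by simp
    have c0: "coeff (initial xx) 0 \<noteq> 0"
      using coeff_0_initial[OF xx_in_range nz(1)] lc_xx by simp
    show False
    proof (rule no_gapped_cusp[OF cop _ _ e(1) pq c0 deg])
      show "i + 2 * e \<le> d * e" if "coeff (initial xx) i \<noteq> 0" "i < d * e" for i
        by (rule gap_of_cusp[OF slope e(1) xx_in_range that(1) _ that(2)]) (simp add: wt_xx)
      show "i + 2 * e \<le> r * e" if "coeff (initial zz) i \<noteq> 0" "i < r * e" for i
        by (rule gap_of_cusp[OF slope e(1) zz_in_range that(1) _ that(2)]) (simp add: wt_zz)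
    qed (use r d in auto)
  qed
qed

lemma ideg_yy_pos: "ideg yy > 0"
  using relation_ideg ideg_xx_0 ideg_zz_pos d by simp

text \<open>
  An invariant has \<open>ideg\<close> zero. Since \<open>y\<close> and \<open>z\<close> have positive \<open>ideg\<close>, its leading monomial is a power
  of \<open>x\<close>. For the lexicographic order this says that the whole element has degree 0 in \<open>Z\<close>.
\<close>

lemma invariant_in_polynomials:
  assumes "a \<in> range ev" "\<forall>n>0. D n a = 0"
  shows "\<exists>p. a = [:emb p:]"
proof (cases "a = 0")
  case True
  then show ?thesis by (intro exI[of _ 0]) simp
next
  case False
  have "coeff (initial a) n = 0" if "n > 0" for n
    using that assms by (simp add: coeff_initial)
  then have "degree (initial a) \<le> 0" by (intro degree_le) auto
  then have 0: "ideg a = 0" by (simp add: ideg_def)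
  obtain i j k where "ideg a = i * ideg xx + j * ideg yy + k * ideg zz" "degree a = d * j + k"
    using range_form[OF assms(1) False] by metis
  then have "degree a = 0" using 0 ideg_yy_pos ideg_zz_pos by simp
  then show ?thesis using range_ev_degree_0 assms(1) by blast
qed

text \<open>
  Adding \<open>ideg zz * u\<close> to \<open>wt zz\<close> leads to a power of \<open>x\<close>, so \<open>u\<close> has negative \<open>Z\<close>-component. A nonzero
  \<open>D n xx\<close> would have negative degree in \<open>Z\<close>.
\<close>

lemma xx_invariant:
  assumes "n > 0"
  shows "D n xx = 0"
proof (rule ccontr)
  assume nz: "D n xx \<noteq> 0"
  define \<beta> where "\<beta> = ideg zz"
  have "zz \<noteq> 0" "xx \<noteq> 0" by simp_all
  note b = leading_derivative[OF zz_in_range this(1)]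
  obtain i where i: "wt (D \<beta> zz) = wt (xx ^ i * bb (degree (D \<beta> zz)))"
    using range_ev_wt[OF b(1,2)] unfolding \<beta>_def by blast
  obtain i' j k where ijk:
    "ideg (D \<beta> zz) = i' * ideg xx + j * ideg yy + k * ideg zz" "degree (D \<beta> zz) = d * j + k"
    using range_form[OF b(1,2)] unfolding \<beta>_def by metis
  then have "degree (D \<beta> zz) = 0"
    using b(4) ideg_yy_pos ideg_zz_pos by (simp add: \<beta>_def)
  then have "wt (D \<beta> zz) = [:of_nat i, 0:]" using i monomial_wt[of i 0] by simp
  then have "of_nat \<beta> * u = [:of_nat i, 0:] - wt zz" using b(3) by (simp add: \<beta>_def)
  then have u: "of_nat \<beta> * u = [:of_nat i, -1:]" by (simp add: wt_zz)
  \<comment> \<open>Scaling by \<open>\<beta> = ideg zz\<close> clears the denominator of \<open>u\<close>.\<close>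
  have "wt_le (D n xx) (wt xx + of_nat n * u)" by (rule slope[OF xx_in_range \<open>xx \<noteq> 0\<close>])
  then have "wt (D n xx) \<le> wt xx + of_nat n * u" using nz by (simp add: wt_le_def)
  then have "of_nat \<beta> * wt (D n xx) \<le> of_nat \<beta> * (wt xx + of_nat n * u)" by (intro mult_left_mono) auto
  also have "\<dots> = of_nat \<beta> * wt xx + of_nat n * (of_nat \<beta> * u)" by (simp add: algebra_simps)
  also have "\<dots> = [:of_nat \<beta> + of_nat n * of_nat i, - of_nat n:]"
    unfolding u by (simp add: wt_xx of_nat_poly)
  also have "of_nat \<beta> * wt (D n xx) = [:of_nat \<beta> * - of_int (fls_subdegree (lead_coeff (D n xx))),
      of_nat \<beta> * of_nat (degree (D n xx)):]"
    by (simp add: wt_def of_nat_poly)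
  finally have "(of_nat \<beta> * of_nat (degree (D n xx)) :: rat) \<le> - of_nat n"
    unfolding lex_le_iff by auto
  moreover have "(of_nat \<beta> * of_nat (degree (D n xx)) :: rat) \<ge> 0" by simp
  ultimately show False using assms by simp
qed

lemma polynomials_invariant:
  assumes "n > 0" shows "D n [:emb p:] = 0"
proof -
  have "\<forall>n>0. D n [:emb p:] = 0"
  proof (induction p)
    case 0
    show ?case by (simp add: D_at_0)
  next
    case (pCons c p)
    have "[:emb (pCons c p):] = scal c + xx * [:emb p:]" by (simp add: emb_pCons)
    moreover have "\<forall>n>0. D n (scal c + xx * [:emb p:]) = 0"
      by (intro constant_add constant_mult scal_in_range range_mult xx_in_range emb_in_range pCons)
         (simp_all add: D_scal xx_invariant)
    ultimately show ?case by (simp only:)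
  qed
  then show ?thesis using assms by blast
qed

end

theorem (in surface_derivation) trivial_or_invariants_polynomials:
  assumes "\<not> (\<forall>a\<in>range ev. \<forall>n>0. D n a = 0)" "a \<in> range ev"
  shows "(\<forall>n>0. D n a = 0) \<longleftrightarrow> (\<exists>p. a = [:emb p:])"
proof -
  obtain u where u: "slope_le u xx (wt xx)" "slope_le u yy (wt yy)" "slope_le u zz (wt zz)"
    and att: "\<exists>g\<in>{xx, yy, zz}. \<exists>i>0. D i g \<noteq> 0 \<and> wt (D i g) = wt g + of_nat i * u"
    using exists_slope[OF assms(1)] by (elim exE conjE) (rule that)
  interpret sloped_derivation "range ev" D u
  proof unfold_locales
    show "wt_le (D i a) (wt a + of_nat i * u)" if "a \<in> range ev" "a \<noteq> 0" for a i
      using slope_of_generators[OF u that] by (simp add: slope_le_def)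
  qed
  obtain g i where gi: "g \<in> {xx, yy, zz}" "i > 0" "D i g \<noteq> 0" "wt (D i g) = wt g + of_nat i * u"
    using att by (elim bexE exE conjE) (rule that)
  then have "g \<in> range ev" using xx_in_range yy_in_range zz_in_range by (elim insertE) simp_all
  then have "coeff (initial g) i \<noteq> 0" using gi(3,4) by (simp add: coeff_initial top_coeff_eq_0_iff)
  then have "ideg g \<ge> i" unfolding ideg_def by (rule le_degree)
  then have "ideg g > 0" using gi(2) by simp
  interpret sloped_surface r d f \<phi> D u
  proof unfold_locales
    show "ideg xx > 0 \<or> ideg yy > 0 \<or> ideg zz > 0"
      using gi(1) \<open>ideg g > 0\<close> by (elim insertE) simp_all
  qed
  show ?thesis using invariant_in_polynomials[OF assms(2)] polynomials_invariant by blast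
qed

section \<open>Polynomial rings over an embedded ring\<close>

lemma upoly_const_zero: "ring R \<Longrightarrow> upoly_const R \<zero>\<^bsub>R\<^esub> = \<zero>\<^bsub>UP R\<^esub>"
  using ring.ring_simprules(2)[of R] by (simp add: upoly_const_def UP_def fun_eq_iff)

text \<open>
  Identities in \<open>A[U]\<close> and \<open>A[U,V]\<close> are checked after an injective homomorphism \<open>H\<close> into a ring that is
  a type. Such a homomorphism extends to polynomials (\<open>upH\<close>), and the extension is again
  an instance of this locale, so two applications reach \<open>A[U,V]\<close>.
\<close>

locale ring_embedding = cring A for A (structure) +
  fixes H :: "'a \<Rightarrow> 'f::comm_ring_1"
  assumes H_zero: "H \<zero> = 0" and H_one: "H \<one> = 1"
    and H_add: "a \<in> carrier A \<Longrightarrow> b \<in> carrier A \<Longrightarrow> H (a \<oplus> b) = H a + H b"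
    and H_mult: "a \<in> carrier A \<Longrightarrow> b \<in> carrier A \<Longrightarrow> H (a \<otimes> b) = H a * H b"
    and H_inj: "a \<in> carrier A \<Longrightarrow> b \<in> carrier A \<Longrightarrow> H a = H b \<Longrightarrow> a = b"
begin

lemma H_finsum:
  assumes "finite I" "g \<in> I \<rightarrow> carrier A"
  shows "H (finsum A g I) = (\<Sum>i\<in>I. H (g i))"
  using assms by (induction I rule: finite_induct) (auto simp: H_zero H_add Pi_def)

lemma H_pow: "a \<in> carrier A \<Longrightarrow> H (a [^] (n::nat)) = H a ^ n"
  by (induction n) (simp_all add: H_one H_mult mult.commute)

definition upH :: "(nat \<Rightarrow> 'a) \<Rightarrow> 'f poly" where
  "upH p = Abs_poly (\<lambda>n. H (p n))"

lemma carrier_UP: "carrier (UP A) = up A"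
  by (simp add: UP_def)

lemma UP_coeff_closed: "p \<in> carrier (UP A) \<Longrightarrow> p n \<in> carrier A"
  by (auto simp: carrier_UP)

lemma UP_bounded:
  assumes "p \<in> carrier (UP A)"
  obtains N where "\<And>n. n > N \<Longrightarrow> p n = \<zero>"
  using assms by (auto simp: carrier_UP up_def bound_def)

lemma coeff_upH:
  assumes "p \<in> carrier (UP A)"
  shows "poly.coeff (upH p) n = H (p n)"
proof -
  obtain N where "\<And>n. n > N \<Longrightarrow> p n = \<zero>" using UP_bounded[OF assms] by blast
  then show ?thesis unfolding upH_def by (subst coeff_Abs_poly[of N]) (auto simp: H_zero)
qed

lemma UP_add: "p \<in> carrier (UP A) \<Longrightarrow> q \<in> carrier (UP A) \<Longrightarrow> (p \<oplus>\<^bsub>UP A\<^esub> q) n = p n \<oplus> q n"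
  by (simp add: UP_def)

lemma UP_mult: "p \<in> carrier (UP A) \<Longrightarrow> q \<in> carrier (UP A) \<Longrightarrow>
    (p \<otimes>\<^bsub>UP A\<^esub> q) n = (\<Oplus>i\<in>{..n}. p i \<otimes> q (n - i))"
  by (simp add: UP_def)

lemma UP_one: "\<one>\<^bsub>UP A\<^esub> n = (if n = 0 then \<one> else \<zero>)"
  by (simp add: UP_def)

lemma UP_zero: "\<zero>\<^bsub>UP A\<^esub> n = \<zero>"
  by (simp add: UP_def)

lemma UP_coeff: "p \<in> carrier (UP A) \<Longrightarrow> up_ring.coeff (UP A) p n = p n"
  by (simp add: UP_def)

lemma UP_const: "a \<in> carrier A \<Longrightarrow> upoly_const A a n = (if n = 0 then a else \<zero>)"
  by (simp add: UP_def upoly_const_def)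

lemma UP_var: "upoly_var A n = (if n = 1 then \<one> else \<zero>)"
  by (simp add: UP_def upoly_var_def)

lemma UP_is_cring: "cring (UP A)"
proof -
  interpret UP_cring A "UP A" by unfold_locales simp
  show ?thesis by (rule UP_cring)
qed

lemma const_closed: "a \<in> carrier A \<Longrightarrow> upoly_const A a \<in> carrier (UP A)"
proof -
  assume a: "a \<in> carrier A"
  interpret UP_cring A "UP A" by unfold_locales simp
  show ?thesis unfolding upoly_const_def using a by (rule monom_closed)
qed

lemma var_closed: "upoly_var A \<in> carrier (UP A)"
proof -
  interpret UP_cring A "UP A" by unfold_locales simp
  show ?thesis unfolding upoly_var_def by (intro monom_closed) simp
qed

lemma ring_embedding_UP: "ring_embedding (UP A) upH"
proof -
  interpret U: cring "UP A" by (rule UP_is_cring)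
  show ?thesis
  proof unfold_locales
    show "upH \<zero>\<^bsub>UP A\<^esub> = 0"
      by (rule poly_eqI) (simp add: coeff_upH UP_zero H_zero)
    show "upH \<one>\<^bsub>UP A\<^esub> = 1"
      by (rule poly_eqI) (simp add: coeff_upH UP_one H_zero H_one coeff_1)
    fix p q assume p: "p \<in> carrier (UP A)" and q: "q \<in> carrier (UP A)"
    note pq = UP_coeff_closed[OF p] UP_coeff_closed[OF q]
    show "upH (p \<oplus>\<^bsub>UP A\<^esub> q) = upH p + upH q"
      by (rule poly_eqI) (simp add: coeff_upH UP_add H_add p q pq)
    show "upH (p \<otimes>\<^bsub>UP A\<^esub> q) = upH p * upH q"
      by (rule poly_eqI) (simp add: coeff_upH UP_mult p q pq H_finsum H_mult coeff_mult Pi_def)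
    assume eq: "upH p = upH q"
    show "p = q"
    proof
      fix n
      have "poly.coeff (upH p) n = poly.coeff (upH q) n" by (simp add: eq)
      then show "p n = q n" using H_inj[OF pq] by (simp add: coeff_upH p q)
    qed
  qed
qed

lemma upH_const: "a \<in> carrier A \<Longrightarrow> upH (upoly_const A a) = [:H a:]"
  by (rule poly_eqI) (simp add: coeff_upH const_closed UP_const H_zero coeff_pCons split: nat.split)

lemma upH_var: "upH (upoly_var A) = [:0, 1:]"
  by (rule poly_eqI)
     (auto simp: coeff_upH var_closed UP_var H_zero H_one coeff_pCons split: nat.split)

lemma eval_closed_and_image:
  assumes S: "ring_embedding S HS" and s: "s \<in> carrier S"
    and h: "\<And>a. a \<in> carrier A \<Longrightarrow> h a \<in> carrier S" "h \<zero> = \<zero>\<^bsub>S\<^esub>" and p: "p \<in> carrier (UP A)"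
    and N: "\<And>n. n > N \<Longrightarrow> p n = \<zero>"
  shows "UnivPoly.eval A S h s p \<in> carrier S"
    and "HS (UnivPoly.eval A S h s p) = (\<Sum>i\<le>N. HS (h (p i)) * HS s ^ i)"
proof -
  interpret S: ring_embedding S HS by (rule S)
  interpret UP_cring A "UP A" by unfold_locales simp
  note coeff = UP_coeff[OF p]
  have ev: "UnivPoly.eval A S h s p = (\<Oplus>\<^bsub>S\<^esub>i\<in>{..deg A p}. h (p i) \<otimes>\<^bsub>S\<^esub> s [^]\<^bsub>S\<^esub> i)"
    using eval_on_carrier[OF p] unfolding coeff .
  have mem: "h (p i) \<in> carrier S" for i using h UP_coeff_closed[OF p] by blast
  show "UnivPoly.eval A S h s p \<in> carrier S"
    unfolding ev by (rule S.finsum_closed) (simp add: mem s)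
  have deg: "deg A p \<le> N"
    by (rule deg_aboveI) (simp_all only: coeff N p)
  have above: "p i = \<zero>" if "i > deg A p" for i
    using deg_aboveD[OF that p] unfolding coeff .
  have "HS (UnivPoly.eval A S h s p) = (\<Sum>i\<le>deg A p. HS (h (p i)) * HS s ^ i)"
    unfolding ev by (subst S.H_finsum) (auto simp: S.H_mult S.H_pow mem s)
  also have "\<dots> = (\<Sum>i\<le>N. HS (h (p i)) * HS s ^ i)"
    by (rule sum.mono_neutral_left) (use deg above h(2) S.H_zero in auto)
  finally show "HS (UnivPoly.eval A S h s p) = (\<Sum>i\<le>N. HS (h (p i)) * HS s ^ i)" .
qed

text \<open>
  Here \<open>V\<close> is \<open>[:[:0, 1:]:]\<close> and \<open>U\<close> is \<open>[:0, 1:]\<close>, so this is the coefficient of \<open>U^i V^j\<close> in \<open>(V + U)^n\<close>.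
\<close>

lemma coeff_binomial:
  "poly.coeff (poly.coeff (([:[:0, 1:]:] + [:0, 1:]) ^ n) i) j = (if n = i + j then of_nat (n choose i) else (0 :: 'f))"
proof -
  let ?V = "[:[:0, 1:]:] :: 'f poly poly" and ?U = "[:0, 1:] :: 'f poly poly"
  have hom: "type_hom (\<lambda>p :: 'f poly. [:p:])" by (simp add: type_hom_def one_pCons)
  have U: "?U ^ k = Polynomial.monom 1 k" for k by (simp add: monom_altdef)
  have V: "?V ^ k = [:Polynomial.monom 1 k:]" for k
    using type_hom_power[OF hom, of "[:0, 1:]" k] by (simp add: monom_altdef)
  have "(?V + ?U) ^ n = (?U + ?V) ^ n" by (simp only: add.commute)
  also have "\<dots> = (\<Sum>k\<le>n. of_nat (n choose k) * ?U ^ k * ?V ^ (n - k))" by (rule binomial_ring)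
  also have "\<dots> = (\<Sum>k\<le>n. Polynomial.monom (of_nat (n choose k) * Polynomial.monom 1 (n - k)) k)"
    unfolding U V by (intro sum.cong refl) (simp add: of_nat_poly smult_monom mult.commute)
  finally have "poly.coeff ((?V + ?U) ^ n) i = (if i \<le> n then of_nat (n choose i) * Polynomial.monom 1 (n - i) else 0)"
    by (simp add: coeff_sum)
  then show ?thesis by (auto simp: of_nat_poly)
qed

text \<open>
  Comparing coefficients of \<open>U^i V^j\<close> in the two sides of the group law: on the left
  it is the coefficient of \<open>V^j\<close> in \<open>\<phi>\<close> applied to the coefficient of \<open>U^i\<close>, on the right the binomial
  theorem applies.
\<close>

lemma exponential_map_iff:
  assumes \<iota>: "range \<iota> \<subseteq> carrier A"
  shows "exponential_map A \<iota> \<phi> \<longleftrightarrow>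
     \<phi> \<in> ring_hom A (UP A) \<and> (\<forall>c. \<phi> (\<iota> c) = upoly_const A (\<iota> c)) \<and>
     (\<forall>a\<in>carrier A. \<phi> a 0 = a) \<and>
     (\<forall>a\<in>carrier A. \<forall>i j. H (\<phi> (\<phi> a i) j) = of_nat ((i + j) choose i) * H (\<phi> a (i + j)))"
proof (cases "\<phi> \<in> ring_hom A (UP A)")
  case True
  interpret U: ring_embedding "UP A" upH by (rule ring_embedding_UP)
  interpret UU: ring_embedding "UP (UP A)" U.upH by (rule U.ring_embedding_UP)
  have self: "ring_embedding A H" by unfold_locales
  have \<phi>: "\<phi> a \<in> carrier (UP A)" if "a \<in> carrier A" for a using True that by (rule ring_hom_closed)
  have \<phi>0: "\<phi> \<zero> = \<zero>\<^bsub>UP A\<^esub>"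
    by (rule ring_hom_zero[OF True]) unfold_locales
  have c1: "upoly_const A \<zero> = \<zero>\<^bsub>UP A\<^esub>" by (rule upoly_const_zero) unfold_locales
  have c2: "upoly_const (UP A) \<zero>\<^bsub>UP A\<^esub> = \<zero>\<^bsub>UP (UP A)\<^esub>" by (rule upoly_const_zero) unfold_locales
  have at0: "UnivPoly.eval A A (\<lambda>b. b) \<zero> (\<phi> a) = \<phi> a 0" if a: "a \<in> carrier A" for a
  proof -
    obtain N where N: "\<And>n. n > N \<Longrightarrow> \<phi> a n = \<zero>" using UP_bounded[OF \<phi>[OF a]] by blast
    have "UnivPoly.eval A A (\<lambda>b. b) \<zero> (\<phi> a) \<in> carrier A"
      by (rule eval_closed_and_image[OF self _ _ _ \<phi>[OF a]]) (use N in auto)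
    moreover have "H (UnivPoly.eval A A (\<lambda>b. b) \<zero> (\<phi> a)) = (\<Sum>i\<le>N. H (\<phi> a i) * H \<zero> ^ i)"
      by (rule eval_closed_and_image[OF self _ _ _ \<phi>[OF a]]) (use N in auto)
    moreover have "\<dots> = (\<Sum>i\<in>{0}. H (\<phi> a i) * H \<zero> ^ i)"
      by (rule sum.mono_neutral_right) (auto simp: H_zero power_0_left)
    ultimately show ?thesis using H_inj UP_coeff_closed[OF \<phi>[OF a]] by simp
  qed
  let ?U = "upoly_var (UP A)" and ?V = "upoly_const (UP A) (upoly_var A)"
  let ?lhs = "\<lambda>a. UnivPoly.eval A (UP (UP A)) (\<lambda>b. upoly_const (UP A) (\<phi> b)) ?U (\<phi> a)"
  let ?rhs = "\<lambda>a. UnivPoly.eval A (UP (UP A)) (\<lambda>b. upoly_const (UP A) (upoly_const A b)) (?V \<oplus>\<^bsub>UP (UP A)\<^esub> ?U) (\<phi> a)"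
  have comp: "?lhs a = ?rhs a \<longleftrightarrow>
      (\<forall>i j. H (\<phi> (\<phi> a i) j) = of_nat ((i + j) choose i) * H (\<phi> a (i + j)))"
    if a: "a \<in> carrier A" for a
  proof -
    obtain N where N: "\<And>n. n > N \<Longrightarrow> \<phi> a n = \<zero>" using UP_bounded[OF \<phi>[OF a]] by blast
    note mem = UP_coeff_closed[OF \<phi>[OF a]]
    have Vmem: "?V \<in> carrier (UP (UP A))" by (intro U.const_closed var_closed)
    have Umem: "?U \<in> carrier (UP (UP A))" by (rule U.var_closed)
    have VU: "?V \<oplus>\<^bsub>UP (UP A)\<^esub> ?U \<in> carrier (UP (UP A))" using Vmem Umem by (rule UU.a_closed)
    have VU': "U.upH (?V \<oplus>\<^bsub>UP (UP A)\<^esub> ?U) = [:[:0, 1:]:] + [:0, 1:]"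
      using UU.H_add[OF Vmem Umem] by (simp only: U.upH_const U.upH_var upH_var var_closed)
    have lc: "?lhs a \<in> carrier (UP (UP A))"
      by (rule eval_closed_and_image[OF UU.ring_embedding_axioms Umem _ _ \<phi>[OF a]])
         (use N \<phi> \<phi>0 c2 U.const_closed in auto)
    have rc: "?rhs a \<in> carrier (UP (UP A))"
      by (rule eval_closed_and_image[OF UU.ring_embedding_axioms VU _ _ \<phi>[OF a]])
         (use N c1 c2 U.const_closed const_closed in auto)
    have "U.upH (?lhs a) = (\<Sum>i\<le>N. U.upH (upoly_const (UP A) (\<phi> (\<phi> a i))) * U.upH ?U ^ i)"
      by (rule eval_closed_and_image[OF UU.ring_embedding_axioms Umem _ _ \<phi>[OF a]])
         (use N \<phi> \<phi>0 c2 U.const_closed in auto)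
    also have "\<dots> = (\<Sum>i\<le>N. Polynomial.monom (upH (\<phi> (\<phi> a i))) i)"
      using \<phi> mem by (simp add: U.upH_const U.upH_var monom_altdef)
    finally have L: "poly.coeff (poly.coeff (U.upH (?lhs a)) i) j = H (\<phi> (\<phi> a i) j)" for i j
    proof -
      assume eq: "U.upH (?lhs a) = (\<Sum>i\<le>N. Polynomial.monom (upH (\<phi> (\<phi> a i))) i)"
      have "poly.coeff (U.upH (?lhs a)) i = (if i \<le> N then upH (\<phi> (\<phi> a i)) else 0)"
        unfolding eq by (simp add: coeff_sum)
      also have "\<dots> = upH (\<phi> (\<phi> a i))" using N[of i] U.H_zero \<phi>0 by simp
      finally show ?thesis using coeff_upH[OF \<phi>[OF mem]] by simp
    qed
    have "U.upH (?rhs a) = (\<Sum>n\<le>N. U.upH (upoly_const (UP A) (upoly_const A (\<phi> a n)))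
        * U.upH (?V \<oplus>\<^bsub>UP (UP A)\<^esub> ?U) ^ n)"
      by (rule eval_closed_and_image[OF UU.ring_embedding_axioms VU _ _ \<phi>[OF a]])
         (use N c1 c2 U.const_closed const_closed in auto)
    also have "\<dots> = (\<Sum>n\<le>N. [:[:H (\<phi> a n):]:] * ([:[:0, 1:]:] + [:0, 1:]) ^ n)"
      unfolding VU' using mem by (simp only: U.upH_const upH_const const_closed)
    finally have eq: "U.upH (?rhs a) = (\<Sum>n\<le>N. [:[:H (\<phi> a n):]:] * ([:[:0, 1:]:] + [:0, 1:]) ^ n)" .
    have R: "poly.coeff (poly.coeff (U.upH (?rhs a)) i) j = of_nat ((i + j) choose i) * H (\<phi> a (i + j))" for i j
    proof -
      have "poly.coeff (poly.coeff (U.upH (?rhs a)) i) j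
          = (\<Sum>n\<le>N. H (\<phi> a n) * poly.coeff (poly.coeff (([:[:0, 1:]:] + [:0, 1:]) ^ n) i) j)"
        unfolding eq coeff_sum by (intro sum.cong refl) simp
      also have "\<dots> = (\<Sum>n\<le>N. if n = i + j then H (\<phi> a (i + j)) * of_nat ((i + j) choose i) else 0)"
        unfolding coeff_binomial by (intro sum.cong refl) simp
      also have "\<dots> = H (\<phi> a (i + j)) * of_nat ((i + j) choose i)"
        using N[of "i + j"] by (auto simp: H_zero)
      finally show ?thesis by (simp only: mult.commute)
    qed
    have "?lhs a = ?rhs a \<longleftrightarrow> U.upH (?lhs a) = U.upH (?rhs a)"
      using UU.H_inj[OF lc rc] by auto
    also have "\<dots> \<longleftrightarrow> (\<forall>i j. poly.coeff (poly.coeff (U.upH (?lhs a)) i) j = poly.coeff (poly.coeff (U.upH (?rhs a)) i) j)"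
      by (simp only: poly_eq_iff)
    finally show ?thesis unfolding L R .
  qed
  show ?thesis unfolding exponential_map_def Let_def
    using True at0 comp by simp
qed (simp add: exponential_map_def)

lemma exp_invariants_eq:
  assumes "\<phi> \<in> ring_hom A (UP A)" "\<forall>a\<in>carrier A. \<phi> a 0 = a"
  shows "exp_invariants A \<phi> = {a \<in> carrier A. \<forall>n>0. H (\<phi> a n) = 0}"
proof -
  have "\<phi> a = upoly_const A a \<longleftrightarrow> (\<forall>n>0. H (\<phi> a n) = 0)" if a: "a \<in> carrier A" for a
  proof
    assume "\<phi> a = upoly_const A a"
    then show "\<forall>n>0. H (\<phi> a n) = 0" using a by (simp add: UP_const H_zero)
  next
    assume 0: "\<forall>n>0. H (\<phi> a n) = 0"
    have mem: "\<phi> a n \<in> carrier A" for n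
      using UP_coeff_closed ring_hom_closed[OF assms(1) a] by blast
    show "\<phi> a = upoly_const A a"
    proof
      fix n
      have "\<phi> a n = \<zero>" if "n > 0" using H_inj[OF mem zero_closed] 0 that H_zero by simp
      then show "\<phi> a n = upoly_const A a n" using a assms(2) by (simp add: UP_const)
    qed
  qed
  then show ?thesis by (auto simp: exp_invariants_def)
qed

end

section \<open>The coordinate ring and its exponential maps\<close>

context surface
begin

abbreviation coord :: "'k poly poly poly set ring" where
  "coord \<equiv> surface_ring f \<phi>"

definition embed :: "'k poly poly poly set \<Rightarrow> 'k fls poly" where
  "embed C = the_elem (ev ` C)"

abbreviation target :: "'k fls poly ring" where
  "target \<equiv> ring_of_type_algebra"

lemma ev_ring_hom_ring: "ring_hom_ring KXYZ target ev"
proof (rule ring_hom_ringI2)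
  show "ev \<in> ring_hom KXYZ target"
    by (rule ring_hom_memI) (simp_all add: ring_of_type_algebra_def type_homD[OF type_hom_ev])
qed (rule ring_from_type_algebra)+

lemma kernel_ev_eq: "a_kernel KXYZ target ev = surface_ideal f \<phi>"
proof -
  have "a_kernel KXYZ target ev = {G. ev G = 0}"
    by (simp add: a_kernel_def' ring_of_type_algebra_def)
  also have "\<dots> = {G. \<exists>H. G = H * rel}" by (simp only: kernel_ev mult.commute)
  also have "\<dots> = surface_ideal f \<phi>"
    by (simp add: surface_ideal_def cgenideal_def ring_of_type_algebra_def rel_def)
  finally show ?thesis .
qed

lemma coord_eq: "coord = KXYZ Quot (a_kernel KXYZ target ev)"
  by (simp only: surface_ring_def kernel_ev_eq)

lemma embed_hom: "embed \<in> ring_hom coord target"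
  using ring_hom_ring.the_elem_hom[OF ev_ring_hom_ring] unfolding embed_def coord_eq .

lemma coord_cring: "cring coord"
  unfolding coord_eq
  by (rule ideal.quotient_is_cring[OF ring_hom_ring.kernel_is_ideal[OF ev_ring_hom_ring]
        cring_from_type_algebra])

lemma embed_inj: "a \<in> carrier coord \<Longrightarrow> b \<in> carrier coord \<Longrightarrow> embed a = embed b \<Longrightarrow> a = b"
  using ring_hom_ring.the_elem_inj[OF ev_ring_hom_ring] unfolding embed_def coord_eq .

lemma embed_range: "embed ` carrier coord = range ev"
  using ring_hom_ring.the_elem_surj[OF ev_ring_hom_ring] unfolding embed_def coord_eq
  by (simp add: ring_of_type_algebra_def)

lemma coset_in_coord: "surface_ideal f \<phi> +>\<^bsub>KXYZ\<^esub> G \<in> carrier coord"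
  by (simp add: surface_ring_def FactRing_def A_RCOSETS_def' ring_of_type_algebra_def) blast

lemma embed_coset: "embed (surface_ideal f \<phi> +>\<^bsub>KXYZ\<^esub> G) = ev G"
  using ring_hom_ring.the_elem_simp[OF ev_ring_hom_ring, of G]
  unfolding embed_def kernel_ev_eq by (simp add: ring_of_type_algebra_def)

lemma emb_closed: "range (surface_emb f \<phi>) \<subseteq> carrier coord"
  by (auto simp: surface_emb_def coset_in_coord)

lemma embed_emb: "embed (surface_emb f \<phi> c) = scal c"
  by (simp add: surface_emb_def embed_coset ev_X emb_const)

lemma embed_x: "embed (surface_x f \<phi>) = xx"
  by (simp add: surface_x_def embed_coset ev_X emb_X)

lemma x_closed: "surface_x f \<phi> \<in> carrier coord"
  by (simp add: surface_x_def coset_in_coord)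

sublocale coord: ring_embedding coord embed
proof -
  interpret cring coord by (rule coord_cring)
  have "embed \<zero>\<^bsub>coord\<^esub> = \<zero>\<^bsub>target\<^esub>"
    by (rule ring_hom_zero[OF embed_hom ring_axioms ring_from_type_algebra])
  then show "ring_embedding coord embed"
    using ring_hom_one[OF embed_hom] ring_hom_add[OF embed_hom] ring_hom_mult[OF embed_hom] embed_inj
    by unfold_locales (simp_all add: ring_of_type_algebra_def)
qed

definition unembed :: "'k fls poly \<Rightarrow> 'k poly poly poly set" where
  "unembed = inv_into (carrier coord) embed"

lemma unembed_closed: "b \<in> range ev \<Longrightarrow> unembed b \<in> carrier coord"
  unfolding unembed_def embed_range[symmetric] by (rule inv_into_into)

lemma embed_unembed: "b \<in> range ev \<Longrightarrow> embed (unembed b) = b"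
  unfolding unembed_def embed_range[symmetric] by (rule f_inv_into_f)

lemma unembed_embed: "a \<in> carrier coord \<Longrightarrow> unembed (embed a) = a"
proof -
  assume a: "a \<in> carrier coord"
  have "inj_on embed (carrier coord)" by (rule inj_onI) (rule embed_inj)
  then show ?thesis unfolding unembed_def using a by (rule inv_into_f_f)
qed

lemma embed_in_range: "a \<in> carrier coord \<Longrightarrow> embed a \<in> range ev"
  using embed_range by blast

definition polys_in_x :: "'k poly poly poly set set" where
  "polys_in_x = {a \<in> carrier coord. \<exists>p. embed a = [:emb p:]}"

text \<open>
  The axioms of an exponential map, moved along the isomorphism \<open>embed\<close> from the coordinate ring to
  \<open>range ev\<close>.
\<close>

lemma derivation_of_exponential_map:
  assumes "exponential_map coord (surface_emb f \<phi>) \<psi>"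
  shows "surface_derivation r d f \<phi> (\<lambda>n b. embed (\<psi> (unembed b) n))"
proof -
  note ex = assms[unfolded coord.exponential_map_iff[OF emb_closed]]
  have hom: "\<psi> \<in> ring_hom coord (UP coord)" using ex by blast
  have \<psi>: "\<psi> a \<in> carrier (UP coord)" if "a \<in> carrier coord" for a
    using hom that by (rule ring_hom_closed)
  note cf = coord.UP_coeff_closed[OF \<psi>]
  have unembed_add: "unembed (a + b) = unembed a \<oplus>\<^bsub>coord\<^esub> unembed b"
    if ab: "a \<in> range ev" "b \<in> range ev" for a b
    by (rule embed_inj[OF unembed_closed[OF range_add[OF ab]] coord.a_closed[OF ab[THEN unembed_closed]]])
       (simp only: embed_unembed[OF range_add[OF ab]] coord.H_add[OF ab[THEN unembed_closed]] ab[THEN embed_unembed])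
  have unembed_mult: "unembed (a * b) = unembed a \<otimes>\<^bsub>coord\<^esub> unembed b"
    if ab: "a \<in> range ev" "b \<in> range ev" for a b
    by (rule embed_inj[OF unembed_closed[OF range_mult[OF ab]] coord.m_closed[OF ab[THEN unembed_closed]]])
       (simp only: embed_unembed[OF range_mult[OF ab]] coord.H_mult[OF ab[THEN unembed_closed]] ab[THEN embed_unembed])
  have unembed_scal: "unembed (scal c) = surface_emb f \<phi> c" for c
    using emb_closed unembed_embed[of "surface_emb f \<phi> c"] by (auto simp: embed_emb)
  show ?thesis
  proof (intro surface_derivation.intro surface_axioms higher_derivation.intro)
    fix c show "scal c \<in> range ev" by (rule scal_in_range)
  next
    fix a b assume ab: "a \<in> range ev" "b \<in> range ev"
    show "a + b \<in> range ev" using ab by (rule range_add)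
    show "a * b \<in> range ev" using ab by (rule range_mult)
    fix n
    note m = unembed_closed[OF ab(1)] unembed_closed[OF ab(2)]
    show "embed (\<psi> (unembed (a + b)) n) = embed (\<psi> (unembed a) n) + embed (\<psi> (unembed b) n)"
      unfolding unembed_add[OF ab] ring_hom_add[OF hom m] coord.UP_add[OF \<psi>[OF m(1)] \<psi>[OF m(2)]]
      by (rule coord.H_add[OF cf[OF m(1)] cf[OF m(2)]])
    have "embed (\<psi> (unembed (a * b)) n)
        = (\<Sum>i\<le>n. embed (\<psi> (unembed a) i \<otimes>\<^bsub>coord\<^esub> \<psi> (unembed b) (n - i)))"
      unfolding unembed_mult[OF ab] ring_hom_mult[OF hom m] coord.UP_mult[OF \<psi>[OF m(1)] \<psi>[OF m(2)]]
      by (rule coord.H_finsum) (auto intro: coord.m_closed cf m)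
    then show "embed (\<psi> (unembed (a * b)) n) = (\<Sum>i\<le>n. embed (\<psi> (unembed a) i) * embed (\<psi> (unembed b) (n - i)))"
      by (simp only: coord.H_mult[OF cf[OF m(1)] cf[OF m(2)]])
  next
    fix a n assume a: "a \<in> range ev"
    show "embed (\<psi> (unembed a) n) \<in> range ev" by (rule embed_in_range[OF cf[OF unembed_closed[OF a]]])
  next
    fix a assume a: "a \<in> range ev"
    show "embed (\<psi> (unembed a) 0) = a" using ex unembed_closed[OF a] embed_unembed[OF a] by simp
  next
    fix n :: nat and c assume "n > 0"
    have c: "surface_emb f \<phi> c \<in> carrier coord" using emb_closed by blast
    have "\<psi> (unembed (scal c)) = upoly_const coord (surface_emb f \<phi> c)" using ex unembed_scal by simp
    then show "embed (\<psi> (unembed (scal c)) n) = 0"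
      using \<open>n > 0\<close> coord.UP_const[OF c, of n] coord.H_zero by simp
  next
    fix a assume a: "a \<in> range ev"
    obtain N where "\<And>n. n > N \<Longrightarrow> \<psi> (unembed a) n = \<zero>\<^bsub>coord\<^esub>"
      using coord.UP_bounded[OF \<psi>[OF unembed_closed[OF a]]] by blast
    then show "\<exists>N. \<forall>n>N. embed (\<psi> (unembed a) n) = 0"
      using coord.H_zero by (intro exI[of _ N] allI impI) simp
  next
    fix a i j assume a: "a \<in> range ev"
    show "embed (\<psi> (unembed (embed (\<psi> (unembed a) i))) j) = of_nat ((i + j) choose i) * embed (\<psi> (unembed a) (i + j))"
      unfolding unembed_embed[OF cf[OF unembed_closed[OF a]]] using ex unembed_closed[OF a] by blast
  qed
qed

text \<open>
  Both invariants are read off from this: every nontrivial exponential map has the same ring of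
  invariants.
\<close>

lemma invariants_dichotomy:
  assumes "exponential_map coord (surface_emb f \<phi>) \<psi>"
  shows "exp_invariants coord \<psi> = carrier coord \<or> exp_invariants coord \<psi> = polys_in_x"
proof -
  interpret surface_derivation r d f \<phi> "\<lambda>n b. embed (\<psi> (unembed b) n)"
    by (rule derivation_of_exponential_map[OF assms])
  note ex = assms[unfolded coord.exponential_map_iff[OF emb_closed]]
  have inv: "exp_invariants coord \<psi> = {a \<in> carrier coord. \<forall>n>0. embed (\<psi> a n) = 0}"
    using ex by (intro coord.exp_invariants_eq) blast+
  show ?thesis
  proof (cases "\<forall>a\<in>range ev. \<forall>n>0. embed (\<psi> (unembed a) n) = 0")
    case True
    have "embed (\<psi> a n) = 0" if "a \<in> carrier coord" "n > 0" for a n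
      using True embed_in_range[OF that(1)] unembed_embed[OF that(1)] that(2) by metis
    then show ?thesis unfolding inv by blast
  next
    case False
    have "(\<forall>n>0. embed (\<psi> a n) = 0) \<longleftrightarrow> (\<exists>p. embed a = [:emb p:])" if "a \<in> carrier coord" for a
      using trivial_or_invariants_polynomials[OF False embed_in_range[OF that]] unembed_embed[OF that] by simp
    then show ?thesis unfolding inv polys_in_x_def by blast
  qed
qed

subsection \<open>A nontrivial exponential map\<close>

text \<open>
  The substitution \<open>Z \<mapsto> Z + f U\<close> on \<open>K((1/X))[Z]\<close>. The factor \<open>f\<close> compensates the denominator of
  \<open>y = \<phi>/f\<close>, so the coordinate ring is mapped into polynomials over itself.
\<close>

definition shear :: "'k fls poly \<Rightarrow> 'k fls poly poly" where
  "shear = eval_hom (\<lambda>c. [:[:c:]:]) [:zz, [:emb f:]:]"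

lemma type_hom_double_const: "type_hom (\<lambda>c :: 'k fls. [:[:c:]:])"
  by (simp add: type_hom_def one_pCons)

lemma type_hom_shear: "type_hom shear"
  unfolding shear_def by (rule type_hom_eval_hom[OF type_hom_double_const])

lemma shear_pCons: "shear (pCons c p) = [:[:c:]:] + [:zz, [:emb f:]:] * shear p"
  unfolding shear_def by (rule eval_hom_pCons[OF type_hom_double_const])

lemma shear_0 [simp]: "shear 0 = 0"
  by (simp add: shear_def)

lemma shear_const: "shear [:c:] = [:[:c:]:]"
  by (simp add: shear_pCons)

lemma coeff_linear_mult:
  "coeff ([:a, b:] * p) n = a * coeff p n + (if n = 0 then 0 else b * coeff p (n - 1))"
  by (cases n) (simp_all add: coeff_pCons)

lemma coeff_shear_pCons:
  "coeff (shear (pCons c p)) n = (if n = 0 then [:c:] else 0) + zz * coeff (shear p) n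
     + (if n = 0 then 0 else [:emb f:] * coeff (shear p) (n - 1))"
  unfolding shear_pCons coeff_add coeff_linear_mult by (simp add: coeff_pCons split: nat.split)

lemma coeff_0_shear: "coeff (shear p) 0 = p"
  by (induction p) (simp_all add: coeff_shear_pCons)

lemma coeff_shear_zz_mult:
  "coeff (shear (zz * p)) n = zz * coeff (shear p) n + (if n = 0 then 0 else [:emb f:] * coeff (shear p) (n - 1))"
proof -
  have "zz * p = pCons 0 p" by simp
  then show ?thesis by (simp only: coeff_shear_pCons) simp
qed

lemma coeff_shear_const_mult: "coeff (shear ([:c:] * p)) n = [:c:] * coeff (shear p) n"
  by (simp only: type_homD(4)[OF type_hom_shear] shear_const) simp

lemma coeff_shear_add: "coeff (shear (p + q)) n = coeff (shear p) n + coeff (shear q) n"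
  by (simp only: type_homD(3)[OF type_hom_shear] coeff_add)

text \<open>
  By induction on the polynomial; the step is the recursion of Pascal's triangle.
\<close>

lemma shear_iterative:
  "coeff (shear (coeff (shear p) i)) j = of_nat ((i + j) choose i) * coeff (shear p) (i + j)"
proof (induction p arbitrary: i j)
  case 0
  show ?case by simp
next
  case (pCons c p)
  show ?case
  proof (cases "i = 0 \<or> j = 0")
    case True
    then show ?thesis by (auto simp: coeff_0_shear)
  next
    case False
    then obtain i' j' where ij: "i = Suc i'" "j = Suc j'" by (metis not0_implies_Suc)
    have l: "coeff (shear (coeff (shear (pCons c p)) i)) j
        = zz * coeff (shear (coeff (shear p) (Suc i'))) (Suc j')
        + [:emb f:] * coeff (shear (coeff (shear p) (Suc i'))) j'
        + [:emb f:] * coeff (shear (coeff (shear p) i')) (Suc j')"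
      unfolding ij
      by (simp only: coeff_shear_pCons coeff_shear_add coeff_shear_zz_mult coeff_shear_const_mult
          Suc_not_Zero if_False diff_Suc_1 add_0_left)
    have r: "coeff (shear (pCons c p)) (i + j) = zz * coeff (shear p) (Suc (Suc (i' + j')))
        + [:emb f:] * coeff (shear p) (Suc (i' + j'))"
      unfolding ij coeff_shear_pCons by simp
    have choose: "(i + j) choose i = (Suc (i' + j') choose i') + (Suc (i' + j') choose Suc i')"
      by (simp add: ij)
    have s: "i + j = Suc (Suc (i' + j'))" by (simp add: ij)
    have "coeff (shear (coeff (shear p) (Suc i'))) (Suc j') = of_nat ((i + j) choose i) * coeff (shear p) (Suc (Suc (i' + j')))"
      and "coeff (shear (coeff (shear p) (Suc i'))) j' = of_nat (Suc (i' + j') choose Suc i') * coeff (shear p) (Suc (i' + j'))"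
      and "coeff (shear (coeff (shear p) i')) (Suc j') = of_nat (Suc (i' + j') choose i') * coeff (shear p) (Suc (i' + j'))"
      unfolding pCons.IH by (simp_all add: ij)
    then show ?thesis
      unfolding l r choose of_nat_add by (simp only:) (simp only: ring_distribs mult_ac add_ac)
  qed
qed

text \<open>
  In \<open>\<phi>(X, Z + f U)\<close> every coefficient of a positive power of \<open>U\<close> is divisible by \<open>f\<close>. After division
  by \<open>f\<close> this says that \<open>y\<close> is mapped to a polynomial over the coordinate ring.
\<close>

lemma coeff_shear_emb_Z:
  "coeff (shear (emb_Z q)) n \<in> range ev \<and> (n > 0 \<longrightarrow> (\<exists>s\<in>range ev. coeff (shear (emb_Z q)) n = [:emb f:] * s))"
proof (induction q arbitrary: n)
  case 0
  show ?case using scal_in_range[of 0] by (auto intro: bexI[of _ 0])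
next
  case (pCons p q)
  show ?case
  proof (cases n)
    case 0
    then show ?thesis using emb_Z_in_range by (simp only: coeff_0_shear) simp
  next
    case (Suc m)
    obtain s where s: "s \<in> range ev" "coeff (shear (emb_Z q)) n = [:emb f:] * s"
      using pCons.IH[of n] Suc by auto
    define t where "t = zz * s + coeff (shear (emb_Z q)) m"
    have t: "t \<in> range ev"
      unfolding t_def using pCons.IH[of m] by (intro range_add range_mult zz_in_range s(1)) blast
    have "coeff (shear (emb_Z (pCons p q))) n = zz * ([:emb f:] * s) + [:emb f:] * coeff (shear (emb_Z q)) m"
      using s(2) Suc unfolding emb_Z_pCons coeff_shear_pCons by simp
    also have "\<dots> = [:emb f:] * t" unfolding t_def by (simp only: distrib_left mult.left_commute)
    finally have eq: "coeff (shear (emb_Z (pCons p q))) n = [:emb f:] * t" .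
    show ?thesis
      unfolding eq by (intro conjI impI bexI[of _ t] range_mult emb_in_range t refl)
  qed
qed

lemma coeff_shear_in_range:
  assumes "a \<in> range ev" shows "coeff (shear a) n \<in> range ev"
proof -
  have "\<forall>n. coeff (shear a) n \<in> range ev"
    using assms
  proof (induction rule: range_ev_induct)
    case (scal c)
    show ?case using scal_in_range[of 0] scal_in_range[of c]
      by (auto simp: shear_const coeff_pCons split: nat.split)
  next
    case x
    show ?case using scal_in_range[of 0] xx_in_range
      by (auto simp: shear_const coeff_pCons split: nat.split)
  next
    case z
    have "zz = emb_Z [:0, 1:]" by simp
    then show ?case using coeff_shear_emb_Z by metis
  next
    case y
    show ?case
    proof
      fix n
      show "coeff (shear yy) n \<in> range ev"
      proof (cases "n = 0")
        case True
        then show ?thesis using yy_in_range by (simp add: coeff_0_shear)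
      next
        case False
        then obtain s where s: "s \<in> range ev" "coeff (shear (emb_Z \<phi>)) n = [:emb f:] * s"
          using coeff_shear_emb_Z by blast
        have "[:emb f:] * coeff (shear yy) n = [:emb f:] * s"
          using s(2) unfolding relation[symmetric] coeff_shear_const_mult .
        then have "coeff (shear yy) n = s" using f_nonzero by (simp only: mult_cancel_left) simp
        then show ?thesis using s(1) by simp
      qed
    qed
  next
    case (add a b)
    then show ?case by (simp add: coeff_shear_add range_add del: range_eqI)
  next
    case (mult a b)
    have sum: "sum g I \<in> range ev" if "finite I" "\<And>i. i \<in> I \<Longrightarrow> g i \<in> range ev" for I :: "nat set" and g
      using that
    proof (induction I rule: finite_induct)
      case empty
      show ?case using scal_in_range[of 0] by simp
    next
      case (insert i I)
      then show ?case unfolding sum.insert[OF insert.hyps] by (intro range_add) blast+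
    qed
    show ?case
    proof
      fix n
      have "coeff (shear (a * b)) n = (\<Sum>i\<le>n. coeff (shear a) i * coeff (shear b) (n - i))"
        by (simp only: type_homD(4)[OF type_hom_shear] coeff_mult)
      also have "\<dots> \<in> range ev" using mult by (intro sum range_mult) auto
      finally show "coeff (shear (a * b)) n \<in> range ev" .
    qed
  qed
  then show ?thesis by blast
qed

definition shear_map :: "'k poly poly poly set \<Rightarrow> nat \<Rightarrow> 'k poly poly poly set" where
  "shear_map a n = unembed (coeff (shear (embed a)) n)"

lemma embed_shear_map:
  assumes "a \<in> carrier coord" shows "embed (shear_map a n) = coeff (shear (embed a)) n"
  unfolding shear_map_def by (rule embed_unembed[OF coeff_shear_in_range[OF embed_in_range[OF assms]]])

lemma shear_map_coeff_closed:
  assumes "a \<in> carrier coord" shows "shear_map a n \<in> carrier coord"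
  unfolding shear_map_def by (rule unembed_closed[OF coeff_shear_in_range[OF embed_in_range[OF assms]]])

lemma shear_map_closed:
  assumes a: "a \<in> carrier coord" shows "shear_map a \<in> carrier (UP coord)"
proof -
  have "shear_map a n = \<zero>\<^bsub>coord\<^esub>" if "n > degree (shear (embed a))" for n
    using embed_shear_map[OF a, of n] that coord.H_zero
    by (intro embed_inj shear_map_coeff_closed a coord.zero_closed) (simp add: coeff_eq_0)
  then have "bound \<zero>\<^bsub>coord\<^esub> (degree (shear (embed a))) (shear_map a)" by (rule bound.intro)
  then show ?thesis using shear_map_coeff_closed[OF a] unfolding coord.carrier_UP by blast
qed

lemma upH_shear_map:
  assumes "a \<in> carrier coord" shows "coord.upH (shear_map a) = shear (embed a)"
  by (rule poly_eqI) (simp add: coord.coeff_upH shear_map_closed embed_shear_map assms)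

text \<open>
  The homomorphism laws hold for \<open>shear\<close> on the large ring and descend by injectivity of \<open>upH\<close>.
\<close>

lemma exponential_map_shear: "exponential_map coord (surface_emb f \<phi>) shear_map"
  unfolding coord.exponential_map_iff[OF emb_closed]
proof (intro conjI ballI allI)
  interpret U: ring_embedding "UP coord" coord.upH by (rule coord.ring_embedding_UP)
  note cl = shear_map_closed
  show "shear_map \<in> ring_hom coord (UP coord)"
  proof (rule ring_hom_memI)
    fix a b assume ab: "a \<in> carrier coord" "b \<in> carrier coord"
    show "shear_map (a \<otimes>\<^bsub>coord\<^esub> b) = shear_map a \<otimes>\<^bsub>UP coord\<^esub> shear_map b"
      using ab by (intro U.H_inj)
        (simp_all add: cl U.H_mult upH_shear_map coord.H_mult type_homD[OF type_hom_shear])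
    show "shear_map (a \<oplus>\<^bsub>coord\<^esub> b) = shear_map a \<oplus>\<^bsub>UP coord\<^esub> shear_map b"
      using ab by (intro U.H_inj)
        (simp_all add: cl U.H_add upH_shear_map coord.H_add type_homD[OF type_hom_shear])
  next
    show "shear_map \<one>\<^bsub>coord\<^esub> = \<one>\<^bsub>UP coord\<^esub>"
      by (intro U.H_inj) (simp_all add: cl U.H_one upH_shear_map coord.H_one type_homD[OF type_hom_shear])
  qed (rule cl)
  fix c
  have c: "surface_emb f \<phi> c \<in> carrier coord" using emb_closed by blast
  show "shear_map (surface_emb f \<phi> c) = upoly_const coord (surface_emb f \<phi> c)"
    using c by (intro U.H_inj) (simp_all add: cl coord.const_closed upH_shear_map coord.upH_const embed_emb shear_const)
next
  fix a assume a: "a \<in> carrier coord"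
  show "shear_map a 0 = a" using a by (simp add: shear_map_def coeff_0_shear unembed_embed)
  fix i j
  show "embed (shear_map (shear_map a i) j) = of_nat (i + j choose i) * embed (shear_map a (i + j))"
    by (simp only: embed_shear_map a shear_map_coeff_closed shear_iterative)
qed

lemma shear_nontrivial: "exp_invariants coord shear_map \<noteq> carrier coord"
proof
  assume eq: "exp_invariants coord shear_map = carrier coord"
  note ex = exponential_map_shear[unfolded coord.exponential_map_iff[OF emb_closed]]
  have inv: "exp_invariants coord shear_map = {a \<in> carrier coord. \<forall>n>0. embed (shear_map a n) = 0}"
    using ex by (intro coord.exp_invariants_eq) blast+
  have z: "unembed zz \<in> carrier coord" by (rule unembed_closed[OF zz_in_range])
  then have "embed (shear_map (unembed zz) 1) = 0" using eq inv by force
  then have "coeff (shear zz) 1 = 0" using embed_shear_map[OF z] embed_unembed[OF zz_in_range] by simp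
  moreover have "coeff (shear zz) 1 = [:emb f:]" by (simp add: coeff_shear_pCons)
  ultimately show False using f_nonzero by simp
qed

subsection \<open>Generated subalgebras\<close>

lemma polys_in_x_closed:
  "\<one>\<^bsub>coord\<^esub> \<in> polys_in_x"
  "a \<in> polys_in_x \<Longrightarrow> \<ominus>\<^bsub>coord\<^esub> a \<in> polys_in_x"
  "a \<in> polys_in_x \<Longrightarrow> b \<in> polys_in_x \<Longrightarrow> a \<oplus>\<^bsub>coord\<^esub> b \<in> polys_in_x"
  "a \<in> polys_in_x \<Longrightarrow> b \<in> polys_in_x \<Longrightarrow> a \<otimes>\<^bsub>coord\<^esub> b \<in> polys_in_x"
proof -
  note hom = type_hom_const_emb
  have "embed \<one>\<^bsub>coord\<^esub> = [:emb 1:]" using coord.H_one type_homD(2)[OF hom] by (simp add: one_pCons)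
  then show "\<one>\<^bsub>coord\<^esub> \<in> polys_in_x" unfolding polys_in_x_def by blast
  show "a \<oplus>\<^bsub>coord\<^esub> b \<in> polys_in_x" if ab: "a \<in> polys_in_x" "b \<in> polys_in_x" for a b
  proof -
    obtain p q where pq: "a \<in> carrier coord" "embed a = [:emb p:]" "b \<in> carrier coord" "embed b = [:emb q:]"
      using ab unfolding polys_in_x_def by blast
    have "embed (a \<oplus>\<^bsub>coord\<^esub> b) = [:emb (p + q):]"
      by (simp only: coord.H_add[OF pq(1,3)] pq type_homD(3)[OF hom])
    moreover have "a \<oplus>\<^bsub>coord\<^esub> b \<in> carrier coord" using pq(1,3) by simp
    ultimately show ?thesis unfolding polys_in_x_def by blast
  qed
  show "a \<otimes>\<^bsub>coord\<^esub> b \<in> polys_in_x" if ab: "a \<in> polys_in_x" "b \<in> polys_in_x" for a b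
  proof -
    obtain p q where pq: "a \<in> carrier coord" "embed a = [:emb p:]" "b \<in> carrier coord" "embed b = [:emb q:]"
      using ab unfolding polys_in_x_def by blast
    have "embed (a \<otimes>\<^bsub>coord\<^esub> b) = [:emb (p * q):]"
      by (simp only: coord.H_mult[OF pq(1,3)] pq type_homD(4)[OF hom])
    moreover have "a \<otimes>\<^bsub>coord\<^esub> b \<in> carrier coord" using pq(1,3) by simp
    ultimately show ?thesis unfolding polys_in_x_def by blast
  qed
  show "\<ominus>\<^bsub>coord\<^esub> a \<in> polys_in_x" if a: "a \<in> polys_in_x"
  proof -
    obtain p where p: "a \<in> carrier coord" "embed a = [:emb p:]" using a unfolding polys_in_x_def by blast
    have "embed (\<ominus>\<^bsub>coord\<^esub> a) + embed a = 0"
      using coord.H_add[of "\<ominus>\<^bsub>coord\<^esub> a" a] p(1) coord.l_neg[OF p(1)] coord.H_zero by simp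
    then have "embed (\<ominus>\<^bsub>coord\<^esub> a) = - [:emb p:]" using p(2) by (simp only: eq_neg_iff_add_eq_0)
    also have "\<dots> = [:emb (- p):]" using type_hom_uminus[OF hom] by metis
    finally show ?thesis using p(1) unfolding polys_in_x_def by blast
  qed
qed

lemma emb_in_polys_in_x: "surface_emb f \<phi> c \<in> polys_in_x"
proof -
  have "embed (surface_emb f \<phi> c) = [:emb [:c:]:]" by (simp only: embed_emb emb_const)
  then show ?thesis using emb_closed unfolding polys_in_x_def by blast
qed

lemma generated_by_x: "generated_subalgebra coord (surface_emb f \<phi>) {surface_x f \<phi>} = polys_in_x"
proof
  show "generated_subalgebra coord (surface_emb f \<phi>) {surface_x f \<phi>} \<subseteq> polys_in_x"
  proof
    fix a assume "a \<in> generated_subalgebra coord (surface_emb f \<phi>) {surface_x f \<phi>}"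
    then show "a \<in> polys_in_x"
      unfolding generated_subalgebra_def
    proof (induction rule: generate_ring.induct)
      case (incl a)
      have "surface_x f \<phi> \<in> polys_in_x"
      proof -
        have "embed (surface_x f \<phi>) = [:emb [:0, 1:]:]" by (simp only: embed_x emb_X)
        then show ?thesis using x_closed unfolding polys_in_x_def by blast
      qed
      then show ?case using incl emb_in_polys_in_x by blast
    qed (auto intro: polys_in_x_closed)
  qed
  show "polys_in_x \<subseteq> generated_subalgebra coord (surface_emb f \<phi>) {surface_x f \<phi>}"
  proof
    let ?G = "generate_ring coord (range (surface_emb f \<phi>) \<union> {surface_x f \<phi>})"
    have G: "\<exists>a\<in>?G. a \<in> carrier coord \<and> embed a = [:emb p:]" for p
    proof (induction p)
      case 0
      have "surface_emb f \<phi> 0 \<in> ?G" by (intro generate_ring.incl) blast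
      then show ?case using embed_emb[of 0] emb_closed by (intro bexI[of _ "surface_emb f \<phi> 0"]) auto
    next
      case (pCons c p)
      then obtain b where b: "b \<in> ?G" "b \<in> carrier coord" "embed b = [:emb p:]" by blast
      define a where "a = surface_emb f \<phi> c \<oplus>\<^bsub>coord\<^esub> surface_x f \<phi> \<otimes>\<^bsub>coord\<^esub> b"
      have c: "surface_emb f \<phi> c \<in> carrier coord" using emb_closed by blast
      have "a \<in> ?G" unfolding a_def
        by (intro generate_ring.eng_add generate_ring.eng_mult b generate_ring.incl) auto
      moreover have "a \<in> carrier coord" unfolding a_def
        by (intro coord.a_closed coord.m_closed c x_closed b)
      moreover have "embed a = scal c + xx * [:emb p:]"
        unfolding a_def using c x_closed b by (simp only: coord.H_add coord.H_mult coord.m_closed embed_emb embed_x)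
      moreover have "\<dots> = [:emb (pCons c p):]" by (simp add: emb_pCons)
      ultimately show ?case by metis
    qed
    fix a assume "a \<in> polys_in_x"
    then obtain p where p: "a \<in> carrier coord" "embed a = [:emb p:]" unfolding polys_in_x_def by blast
    obtain b where "b \<in> ?G" "b \<in> carrier coord" "embed b = [:emb p:]" using G by blast
    then have "a \<in> ?G" using embed_inj[of a b] p by simp
    then show "a \<in> generated_subalgebra coord (surface_emb f \<phi>) {surface_x f \<phi>}"
      by (simp only: generated_subalgebra_def)
  qed
qed

lemma generated_by_polys_in_x: "generated_subalgebra coord (surface_emb f \<phi>) polys_in_x = polys_in_x"
proof
  show "generated_subalgebra coord (surface_emb f \<phi>) polys_in_x \<subseteq> polys_in_x"
  proof
    fix a assume "a \<in> generated_subalgebra coord (surface_emb f \<phi>) polys_in_x"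
    then show "a \<in> polys_in_x"
      unfolding generated_subalgebra_def
    proof (induction rule: generate_ring.induct)
      case (incl a)
      then show ?case using emb_in_polys_in_x by blast
    qed (auto intro: polys_in_x_closed)
  qed
qed (auto simp: generated_subalgebra_def intro: generate_ring.incl)

theorem makar_limanov_coord: "makar_limanov coord (surface_emb f \<phi>) = polys_in_x"
proof -
  have "exp_invariants coord shear_map = polys_in_x"
    using invariants_dichotomy[OF exponential_map_shear] shear_nontrivial by blast
  moreover have "polys_in_x \<subseteq> exp_invariants coord \<psi>" if "exponential_map coord (surface_emb f \<phi>) \<psi>" for \<psi>
    using invariants_dichotomy[OF that] unfolding polys_in_x_def by blast
  ultimately show ?thesis
    unfolding makar_limanov_def using exponential_map_shear by blast
qed

theorem derksen_coord: "derksen coord (surface_emb f \<phi>) = polys_in_x"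
proof -
  have "(\<Union>\<psi> \<in> {\<psi>. exponential_map coord (surface_emb f \<phi>) \<psi> \<and> exp_invariants coord \<psi> \<noteq> carrier coord}.
      exp_invariants coord \<psi>) = polys_in_x" (is "\<Union> (_ ` ?N) = _")
  proof -
    have "exp_invariants coord \<psi> = polys_in_x" if "\<psi> \<in> ?N" for \<psi>
      using invariants_dichotomy that by blast
    moreover have "shear_map \<in> ?N" using exponential_map_shear shear_nontrivial by blast
    ultimately show ?thesis by blast
  qed
  then show ?thesis unfolding derksen_def by (simp only: generated_by_polys_in_x)
qed

end

lemma monic_of_monomials:
  fixes b :: "nat \<Rightarrow> 'a::comm_ring_1"
  assumes "p = Polynomial.monom 1 n + (\<Sum>i<n. Polynomial.monom (b i) i)"
  shows "degree p = n" "lead_coeff p = 1"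
proof -
  have "coeff p i = (if i = n then 1 else if i < n then b i else 0)" for i
    unfolding assms by (auto simp: coeff_sum)
  then have "coeff p n = 1" "\<And>i. i > n \<Longrightarrow> coeff p i = 0" by auto
  then show "degree p = n" by (metis degree_le le_antisym le_degree zero_neq_one)
  with \<open>coeff p n = 1\<close> show "lead_coeff p = 1" by simp
qed

theorem corollary3p6:
  fixes r d :: nat
    and a :: "nat \<Rightarrow> 'k::field"
    and c :: "nat \<Rightarrow> 'k poly"
    and f :: "'k poly"
    and \<phi> :: "'k poly poly"
  assumes "r \<ge> 2" and "d \<ge> 2"
    and "f = Polynomial.monom 1 r + (\<Sum>i<r. Polynomial.monom (a i) i)"
    and "\<phi> = Polynomial.monom 1 d + (\<Sum>i<d. Polynomial.monom (c i) i)"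
  shows "makar_limanov (surface_ring f \<phi>) (surface_emb f \<phi>)
           = generated_subalgebra (surface_ring f \<phi>) (surface_emb f \<phi>) {surface_x f \<phi>} \<and>
         derksen (surface_ring f \<phi>) (surface_emb f \<phi>)
           = generated_subalgebra (surface_ring f \<phi>) (surface_emb f \<phi>) {surface_x f \<phi>}"
proof -
  interpret surface r d f \<phi>
    using assms(1,2) monic_of_monomials[OF assms(3)] monic_of_monomials[OF assms(4)]
    by unfold_locales
  show ?thesis
    by (simp only: makar_limanov_coord derksen_coord generated_by_x)
qed

end
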